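(* Let $\varepsilon\in(0,1/4)$ and $c$ a suitably large constant. The Semi-streaming Truncated-Pivot algorithm with smaller memory (described in the context) computes, in a single pass of the semi-streaming model in the adaptive-order setting, a clustering whose expected cost is at most $(3+\varepsilon)\cdot\mathrm{OPT}(G)$, and it requires $O(n\log n/\varepsilon)$ words of memory with high probability.
   Context: Correlation clustering: input is a simple undirected graph $G=(V,E^+)$ on $n$ nodes (positive edges); distinct non-adjacent pairs are negative. The cost of a partition of $V$ into clusters is the number of positive edges between different clusters plus the number of negative pairs inside clusters; $\mathrm{OPT}(G)$ is the minimum cost. $\deg(u)$ is the degree in $G$. Semi-streaming model: the edges of $G$ arrive as a stream read once; memory is measured in words of $O(\log n)$ bits. Adaptive-order: the graph is fixed beforehand but the arrival order of edges may depend on the algorithm's previous random choices. With high probability = with probability at least $1-n^{-c'}$ for a large constant $c'$. Algorithm: define $\theta_0=\lceil\frac{4c}{\varepsilon}\log n\rceil$, $\theta_j=2\theta_{j-1}$, degree classes $C_0=[0,\theta_0]$, $C_j=[\theta_{j-1}+1,\theta_j]$ ($j\ge1$). Every node counts its current degree, starts in $C_0$, starts interesting, with empty bit string $r_u$. Interesting nodes store all their revealed incident edges. When an edge is revealed, both endpoints update their degree; if an endpoint $u$ switches degree class, it flips a fair coin, appends the result as the next bit of $r_u$; on $0$ it stays interesting, on $1$ it becomes uninteresting, deletes its stored edges and stores no further edges (but keeps counting its degree). After the stream: each node completes $r_u$ to length $a\log n$ (fixed constant $a$) with independent fair bits; ordering nodes by $r_u$ yields a permutation $\pi:V\to\{1,\dots,n\}$.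 Let $\tau_v=\frac{c}{\varepsilon}\cdot\frac{n\log n}{\deg(v)}$; additionally every node $v$ with $\pi_v\ge\tau_v$ becomes uninteresting. Let $G_{\mathrm{store}}$ be the subgraph induced by interesting nodes, $\mathcal{I}$ the greedy maximal independent set of $G_{\mathrm{store}}$ in order $\pi$; nodes of $\mathcal{I}$ are pivots; each $v\in V\setminus\mathcal{I}$ joins the cluster of its smallest-$\pi$ pivot neighbor $u$ if $\pi_u<\tau_v$; remaining nodes form singleton clusters.
   Formalization: The bound (3+ε)·OPT(G) is proved when OPT(G)>0; if OPT(G)=0 it fails literally (large cliques: all nodes may become uninteresting), and expected cost at most n^{-c'} is proved instead. The memory bound is for n≥2; a≥1, and ties between bit strings are broken uniformly at random. *)

theory Defs
  imports
    "HOL-Probability.Probability"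
    "HOL-Probability.Product_PMF"
    "HOL-Probability.Random_Permutations"
    "HOL-Library.Disjoint_Sets"
begin

section \<open>Correlation clustering\<close>

definition simple_graph :: "'v set \<Rightarrow> 'v set set \<Rightarrow> bool" where
  "simple_graph V E \<longleftrightarrow> finite V \<and> E \<subseteq> {e. e \<subseteq> V \<and> card e = 2}"

definition clustering_cost :: "'v set \<Rightarrow> 'v set set \<Rightarrow> 'v set set \<Rightarrow> nat" where
  "clustering_cost V E P =
     card {e \<in> E. \<not> (\<exists>X\<in>P. e \<subseteq> X)} +
     card {e. e \<subseteq> V \<and> card e = 2 \<and> e \<notin> E \<and> (\<exists>X\<in>P. e \<subseteq> X)}"

definition OPT :: "'v set \<Rightarrow> 'v set set \<Rightarrow> nat" where
  "OPT V E = Min (clustering_cost V E ` {P. partition_on V P})"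


section \<open>Degree classes\<close>

definition theta0 :: "nat \<Rightarrow> real \<Rightarrow> real \<Rightarrow> nat" where
  "theta0 n \<epsilon> c = nat \<lceil>4 * c / \<epsilon> * log 2 (real n)\<rceil>"

fun theta :: "nat \<Rightarrow> nat \<Rightarrow> nat" where
  "theta t0 0 = t0"
| "theta t0 (Suc j) = 2 * theta t0 j"

fun degree_class :: "nat \<Rightarrow> nat \<Rightarrow> nat set" where
  "degree_class t0 0 = {0..theta t0 0}"
| "degree_class t0 (Suc j) = {theta t0 j + 1..theta t0 (Suc j)}"

definition switches_class :: "nat \<Rightarrow> nat \<Rightarrow> nat \<Rightarrow> bool" where
  "switches_class t0 d d' \<longleftrightarrow> \<not> (\<exists>j. d \<in> degree_class t0 j \<and> d' \<in> degree_class t0 j)"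


section \<open>The streaming phase\<close>

record 'v alg_state =
  cur_deg :: "'v \<Rightarrow> nat"
  bits :: "'v \<Rightarrow> bool list"
  interesting :: "'v \<Rightarrow> bool"
  stored :: "'v \<Rightarrow> 'v set set"

definition init_state :: "'v alg_state" where
  "init_state = \<lparr>cur_deg = (\<lambda>_. 0), bits = (\<lambda>_. []), interesting = (\<lambda>_. True), stored = (\<lambda>_. {})\<rparr>"

abbreviation fair_coin :: "bool pmf" where
  "fair_coin \<equiv> bernoulli_pmf (1 / 2)"

text \<open>The bits 0 and 1 are \<open>False\<close> and \<open>True\<close>. A node that is already uninteresting goes on
  flipping coins when it switches class (its bits then only determine its position in the final
  order), but it never becomes interesting again.\<close>

definition update_state :: "'v set \<Rightarrow> 'v set \<Rightarrow> ('v \<Rightarrow> bool) \<Rightarrow> 'v alg_state \<Rightarrow> 'v alg_state" where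
  "update_state e W b s =
     (let intr = (\<lambda>u. interesting s u \<and> \<not> (u \<in> W \<and> b u)) in
      \<lparr>cur_deg = (\<lambda>u. if u \<in> e then cur_deg s u + 1 else cur_deg s u),
       bits = (\<lambda>u. if u \<in> W then bits s u @ [b u] else bits s u),
       interesting = intr,
       stored = (\<lambda>u. if intr u then (if u \<in> e then insert e (stored s u) else stored s u) else {})\<rparr>)"

definition process_edge :: "nat \<Rightarrow> 'v set \<Rightarrow> 'v alg_state \<Rightarrow> 'v alg_state pmf" where
  "process_edge t0 e s =
     (let W = {u \<in> e. switches_class t0 (cur_deg s u) (cur_deg s u + 1)} in
      map_pmf (\<lambda>b. update_state e W b s) (Pi_pmf W False (\<lambda>_. fair_coin)))"

text \<open>A history lists the revealed edges, each with the state of the algorithm after processing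
  it, and hence all random choices made so far. An adaptive order of a fixed edge set picks the
  next edge, one not revealed yet, as a function of the history.\<close>

type_synonym 'v history = "('v set \<times> 'v alg_state) list"

definition adaptive_order :: "'v set set \<Rightarrow> ('v history \<Rightarrow> 'v set) \<Rightarrow> bool" where
  "adaptive_order E next_edge \<longleftrightarrow>
     (\<forall>h. fst ` set h \<subset> E \<longrightarrow> next_edge h \<in> E - fst ` set h)"

definition cur_state :: "'v history \<Rightarrow> 'v alg_state" where
  "cur_state h = (if h = [] then init_state else snd (last h))"

primrec stream_phase :: "nat \<Rightarrow> ('v history \<Rightarrow> 'v set) \<Rightarrow> nat \<Rightarrow> 'v history pmf" where
  "stream_phase t0 next_edge 0 = return_pmf []"
| "stream_phase t0 next_edge (Suc k) =
     bind_pmf (stream_phase t0 next_edge k) (\<lambda>h.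
       map_pmf (\<lambda>s. h @ [(next_edge h, s)]) (process_edge t0 (next_edge h) (cur_state h)))"


section \<open>After the stream\<close>

definition string_length :: "nat \<Rightarrow> real \<Rightarrow> nat" where
  "string_length n a = nat \<lceil>a * log 2 (real n)\<rceil>"

definition complete_strings :: "'v set \<Rightarrow> nat \<Rightarrow> 'v alg_state \<Rightarrow> ('v \<Rightarrow> bool list) pmf" where
  "complete_strings V L s =
     Pi_pmf V [] (\<lambda>u. map_pmf (\<lambda>x. bits s u @ x)
       (replicate_pmf (L - length (bits s u)) fair_coin))"

text \<open>The permutation \<open>\<pi>\<close> is represented by the list of all nodes in increasing order of \<open>\<pi>\<close>.
  Nodes with equal bit strings are ordered uniformly at random; if all strings are distinct,
  the set below is a singleton.\<close>

definition compatible_orders :: "'v set \<Rightarrow> ('v \<Rightarrow> bool list) \<Rightarrow> 'v list set" where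
  "compatible_orders V r =
     {xs \<in> permutations_of_set V. sorted_wrt (\<lambda>u v. lexordp_eq (r u) (r v)) xs}"

definition rank :: "'v list \<Rightarrow> 'v \<Rightarrow> nat" where
  "rank xs v = length (takeWhile (\<lambda>w. w \<noteq> v) xs) + 1"

text \<open>\<open>below_tau n \<epsilon> c d k\<close> says \<open>k < \<tau>\<^sub>v\<close> for a node \<open>v\<close> of degree \<open>d\<close>; the threshold of an
  isolated node is infinite.\<close>

definition below_tau :: "nat \<Rightarrow> real \<Rightarrow> real \<Rightarrow> nat \<Rightarrow> nat \<Rightarrow> bool" where
  "below_tau n \<epsilon> c d k \<longleftrightarrow>
     d = 0 \<or> real k < c / \<epsilon> * (real n * log 2 (real n) / real d)"

definition final_interesting ::
    "'v set \<Rightarrow> real \<Rightarrow> real \<Rightarrow> 'v alg_state \<Rightarrow> 'v list \<Rightarrow> 'v set" where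
  "final_interesting V \<epsilon> c s xs =
     {v \<in> V. interesting s v \<and> below_tau (card V) \<epsilon> c (cur_deg s v) (rank xs v)}"

text \<open>Everything below is computed from the final state only. Interesting nodes hold all their
  incident edges, so the stored edges between them form the subgraph they induce, and the edges
  stored by a pivot are all its incident edges.\<close>

definition store_graph :: "'v alg_state \<Rightarrow> 'v set \<Rightarrow> 'v set set" where
  "store_graph s J = {e \<in> (\<Union>u\<in>J. stored s u). e \<subseteq> J}"

primrec greedy_mis :: "'v set set \<Rightarrow> 'v set \<Rightarrow> 'v list \<Rightarrow> 'v set" where
  "greedy_mis F M [] = M"
| "greedy_mis F M (v # vs) =
     greedy_mis F (if \<exists>u\<in>M. {u, v} \<in> F then M else insert v M) vs"

definition pivots :: "'v set \<Rightarrow> real \<Rightarrow> real \<Rightarrow> 'v alg_state \<Rightarrow> 'v list \<Rightarrow> 'v set" where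
  "pivots V \<epsilon> c s xs =
     (let J = final_interesting V \<epsilon> c s xs
      in greedy_mis (store_graph s J) {} (filter (\<lambda>v. v \<in> J) xs))"

definition cluster_label ::
    "'v set \<Rightarrow> real \<Rightarrow> real \<Rightarrow> 'v alg_state \<Rightarrow> 'v list \<Rightarrow> 'v \<Rightarrow> 'v" where
  "cluster_label V \<epsilon> c s xs v =
     (let M = pivots V \<epsilon> c s xs;
          N = {u \<in> M. {u, v} \<in> stored s u};
          u = arg_min_on (rank xs) N
      in if v \<notin> M \<and> N \<noteq> {} \<and> below_tau (card V) \<epsilon> c (cur_deg s v) (rank xs u) then u else v)"

definition output_clustering ::
    "'v set \<Rightarrow> real \<Rightarrow> real \<Rightarrow> 'v alg_state \<Rightarrow> 'v list \<Rightarrow> 'v set set" where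
  "output_clustering V \<epsilon> c s xs =
     (\<lambda>v. {w \<in> V. cluster_label V \<epsilon> c s xs w = cluster_label V \<epsilon> c s xs v}) ` V"


section \<open>Memory\<close>

text \<open>A word has \<open>\<lceil>log\<^sub>2 n\<rceil>\<close> bits. Every node uses one word for its degree, one for its
  interesting flag, as many as needed for its bit string, and two for every edge it stores. After
  the stream there are three more words per node: its position, a pivot mark and a cluster label.\<close>

definition word_bits :: "nat \<Rightarrow> nat" where
  "word_bits n = nat \<lceil>log 2 (real n)\<rceil>"

definition state_words :: "'v set \<Rightarrow> 'v alg_state \<Rightarrow> nat" where
  "state_words V s =
     (\<Sum>u\<in>V. 2 + nat \<lceil>real (length (bits s u)) / real (word_bits (card V))\<rceil> + 2 * card (stored s u))"

definition peak_words :: "'v set \<Rightarrow> 'v history \<Rightarrow> ('v \<Rightarrow> bool list) \<Rightarrow> nat" where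
  "peak_words V h r =
     Max (insert (state_words V init_state)
       (insert (state_words V ((cur_state h)\<lparr>bits := r\<rparr>) + 3 * card V)
         ((\<lambda>(e, s). state_words V s) ` set h)))"


section \<open>The algorithm\<close>

text \<open>Joint distribution of the computed clustering and the peak number of words in use. The
  edge set \<open>E\<close> enters only through the length of the stream.\<close>

definition streaming_truncated_pivot ::
    "real \<Rightarrow> real \<Rightarrow> real \<Rightarrow> 'v set \<Rightarrow> 'v set set \<Rightarrow> ('v history \<Rightarrow> 'v set) \<Rightarrow> ('v set set \<times> nat) pmf" where
  "streaming_truncated_pivot \<epsilon> c a V E next_edge =
     bind_pmf (stream_phase (theta0 (card V) \<epsilon> c) next_edge (card E)) (\<lambda>h.
     bind_pmf (complete_strings V (string_length (card V) a) (cur_state h)) (\<lambda>r.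
     bind_pmf (pmf_of_set (compatible_orders V r)) (\<lambda>xs.
     return_pmf (output_clustering V \<epsilon> c (cur_state h) xs, peak_words V h r))))"

end

theory Submission
  imports Defs
begin

text \<open>Completing the bit strings after each edge does not change their law, so the final strings
  are uniform and the order is a uniformly random permutation whatever the adversary does, while
  the final state is a function of the strings.

  In a random order, a truncated node is one that is still unclustered at time \<open>\<tau>\<^sub>v\<close>. Up to that time
  each bad triangle whose nodes are all alive is equally likely to be hit at any of its three
  nodes, so the cost caused by pivots is at most \<open>3 OPT\<close> by the usual triangle charging. A
  neighbour alive at time \<open>\<tau>\<^sub>v\<close> had a chance at each step to become a pivot adjacent to \<open>v\<close>, so a
  truncated node has with high probability at most \<open>\<epsilon>/16 deg v\<close> of them; its other edges are cut
  anyway and pay for these. A Chernoff bound shows that nodes of position below \<open>\<tau>\<^sub>v\<close> start with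
  enough zeros to be interesting. All failure events are impossible for \<open>\<epsilon> \<le> 1/n\<close>, hence their
  contribution to the expected cost is below \<open>\<epsilon>/4\<close> for every \<open>\<epsilon>\<close>.

  For the memory, the product over all nodes of \<open>1 + \<beta> 2\<^sup>j\<close> (\<open>j\<close> the degree class, for interesting
  nodes) is a martingale under every adaptive order and dominates the exponential of the number
  of stored edges divided by \<open>n\<close>; a maximal inequality bounds its peak.\<close>

section \<open>Pivots in a fixed order and the triangle charging\<close>

text \<open>The obstacle: the adversary sees coins that later decide the order, so stream and order
  are correlated. For the cost this disappears, because the clustering depends only on
  \<open>E\<close>, the completed strings and the order drawn from them. No stream is left in the
  cost analysis. Thresholds differ between the nodes of a triangle. The condition that all three are
  alive at the hit position is symmetric in them, which keeps the three hits equally likely. What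
  truncation loses is assigned to the endpoint of larger degree, whose threshold is the earlier one.
  Failures need degrees above \<open>1/\<epsilon>\<close>: only then does a node leave class 0 or
  have a threshold within \<open>n\<close>. This is why they vanish for
  \<open>\<epsilon> \<le> 1/n\<close>. Constants: a cut edge is counted at up to two endpoints, so
  \<open>\<epsilon>/16\<close> costs a factor \<open>1 - \<epsilon>/8\<close>, and
  \<open>3 / (1 - \<epsilon>/8) \<le> 3 + 3\<epsilon>/4\<close> leaves \<open>\<epsilon>/4\<close>
  for failures, absorbed because a positive optimum is at least 1. The 4 in \<open>theta0\<close>
  makes the threshold of a node of class \<open>j > 0\<close> at most half the expected number of
  strings with \<open>j\<close> leading zeros.\<close>

definition error_pairs :: "'v set \<Rightarrow> 'v set set \<Rightarrow> 'v set set \<Rightarrow> 'v set set" where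
  "error_pairs V E P = {e \<in> E. \<not> (\<exists>X\<in>P. e \<subseteq> X)} \<union>
     {e. e \<subseteq> V \<and> card e = 2 \<and> e \<notin> E \<and> (\<exists>X\<in>P. e \<subseteq> X)}"

lemma finite_pairs: "finite V \<Longrightarrow> finite {e. e \<subseteq> V \<and> card e = 2}"
  by (rule finite_subset[of _ "Pow V"]) auto

lemma simple_graph_finite_edges: "simple_graph V E \<Longrightarrow> finite E"
  unfolding simple_graph_def using finite_pairs finite_subset by metis

lemma finite_error_pairs: "simple_graph V E \<Longrightarrow> finite (error_pairs V E P)"
  by (rule finite_subset[of _ "{e. e \<subseteq> V \<and> card e = 2}"])
     (auto simp: error_pairs_def simple_graph_def finite_pairs)

lemma clustering_cost_eq_card_error_pairs:
  assumes "simple_graph V E"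
  shows "clustering_cost V E P = card (error_pairs V E P)"
proof -
  have f: "finite (error_pairs V E P)" using finite_error_pairs[OF assms] .
  show ?thesis unfolding clustering_cost_def error_pairs_def
    by (rule card_Un_disjoint[symmetric]) (use f in \<open>auto simp: error_pairs_def\<close>)
qed

text \<open>The worst-case price paid when a failure event occurs.\<close>

lemma clustering_cost_le_square:
  assumes "simple_graph V E"
  shows "clustering_cost V E P \<le> (card V)\<^sup>2"
proof -
  have fin: "finite V" using assms by (simp add: simple_graph_def)
  have "card (error_pairs V E P) \<le> card {e. e \<subseteq> V \<and> card e = 2}"
    by (rule card_mono) (use assms finite_pairs[OF fin] in \<open>auto simp: error_pairs_def simple_graph_def\<close>)
  also have "\<dots> = card V choose 2" using fin by (simp add: n_subsets)
  also have "\<dots> \<le> (card V)\<^sup>2"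
    using binomial_le_pow[of 2 "card V"] by (cases "card V \<ge> 2") (auto simp: binomial_eq_0)
  finally show ?thesis using clustering_cost_eq_card_error_pairs[OF assms] by simp
qed

lemma OPT_attained:
  assumes "finite V"
  shows "\<exists>Q. partition_on V Q \<and> clustering_cost V E Q = OPT V E"
proof -
  let ?Q = "{P. partition_on V P}"
  have "?Q \<subseteq> Pow (Pow V)" by (auto simp: partition_on_def)
  hence "finite ?Q" using assms finite_subset by blast
  moreover have "(\<lambda>x. {x}) ` V \<in> ?Q"
    by (auto simp: partition_on_def disjoint_def)
  ultimately have "Min (clustering_cost V E ` ?Q) \<in> clustering_cost V E ` ?Q"
    by (intro Min_in) blast+
  thus ?thesis by (auto simp: OPT_def)
qed

section \<open>Positions in a list\<close>

lemma rank_less_iff_in_takeWhile: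
  assumes "u \<in> set xs" "distinct xs" "x \<in> set xs"
  shows "rank xs x < rank xs u \<longleftrightarrow> x \<in> set (takeWhile (\<lambda>w. w \<noteq> u) xs)"
  using assms
proof (induction xs)
  case (Cons y ys)
  show ?case
  proof (cases "y = u")
    case True thus ?thesis by (simp add: rank_def)
  next
    case yu: False
    show ?thesis
    proof (cases "y = x")
      case True thus ?thesis using yu Cons.prems by (simp add: rank_def)
    next
      case False
      thus ?thesis using yu Cons by (auto simp: rank_def)
    qed
  qed
qed simp

lemma rank_append_Cons: "u \<notin> set p \<Longrightarrow> rank (p @ u # q) u = Suc (length p)"
  by (simp add: rank_def takeWhile_append)

lemma rank_le_length: "u \<in> set xs \<Longrightarrow> rank xs u \<le> length xs"
  by (induction xs) (auto simp: rank_def)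

lemma rank_inj_on: "inj_on (rank xs) (set xs)"
proof (rule inj_onI)
  fix x y assume *: "x \<in> set xs" "y \<in> set xs" "rank xs x = rank xs y"
  have "xs ! (rank xs z - 1) = z" if "z \<in> set xs" for z
    using that by (induction xs) (auto simp: rank_def)
  thus "x = y" using * by metis
qed

lemma rank_le_iff_in_take:
  assumes "distinct xs" "u \<in> set xs"
  shows "rank xs u \<le> k \<longleftrightarrow> u \<in> set (take k xs)"
  using assms
proof (induction xs arbitrary: k)
  case (Cons y ys)
  show ?case
  proof (cases k)
    case 0 thus ?thesis by (simp add: rank_def)
  next
    case (Suc k')
    show ?thesis
    proof (cases "y = u")
      case True thus ?thesis by (simp add: rank_def Suc)
    next
      case False
      hence "rank (y # ys) u = Suc (rank ys u)" by (simp add: rank_def)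
      thus ?thesis using Cons False Suc by auto
    qed
  qed
qed simp

text \<open>The edge set is a parameter so that the same notion also serves the edges revealed so
  far in an unfinished stream.\<close>

definition vdeg :: "'v set set \<Rightarrow> 'v \<Rightarrow> nat" where
  "vdeg E v = card {e \<in> E. v \<in> e}"

text \<open>\<open>ok v i\<close> abstracts \<open>i < tau v\<close>. The charging rests on two
  monotonicities: admissible positions form an initial segment, and this segment does not shrink
  when the degree does.\<close>

locale truncated_pivot =
  fixes V :: "'v set" and E :: "'v set set" and ok :: "'v \<Rightarrow> nat \<Rightarrow> bool"
  assumes graph: "simple_graph V E"
    and ok_antimono: "ok v i \<Longrightarrow> j \<le> i \<Longrightarrow> ok v j"
    and ok_degree: "vdeg E w \<le> vdeg E v \<Longrightarrow> ok v i \<Longrightarrow> ok w i"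
begin

lemma finite_V: "finite V" using graph by (simp add: simple_graph_def)
lemma finite_E: "finite E" using graph by (rule simple_graph_finite_edges)

lemma edgeD: "{u, v} \<in> E \<Longrightarrow> u \<in> V \<and> v \<in> V \<and> u \<noteq> v"
  using graph by (auto simp: simple_graph_def)

lemma edge_sym: "{u, v} \<in> E \<Longrightarrow> {v, u} \<in> E"
  by (simp add: insert_commute)

lemma edge_cases: assumes "e \<in> E" obtains u v where "e = {u, v}" "u \<noteq> v" "u \<in> V" "v \<in> V"
proof -
  have "card e = 2" "e \<subseteq> V" using assms graph by (auto simp: simple_graph_def)
  thus ?thesis using that by (auto simp: card_2_iff)
qed

text \<open>The argument is a prefix of the order in reverse, so the node processed last comes first.\<close>

primrec piv :: "'v list \<Rightarrow> 'v set" where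
  "piv [] = {}"
| "piv (x # q) = (if ok x (Suc (length q)) \<and> (\<forall>u\<in>piv q. {u, x} \<notin> E)
     then insert x (piv q) else piv q)"

definition killed :: "'v list \<Rightarrow> 'v \<Rightarrow> bool" where
  "killed q w \<longleftrightarrow> (\<exists>u\<in>piv q. u = w \<or> {u, w} \<in> E)"

text \<open>The position tested is that of the node about to be processed, one past the prefix
  \<open>q\<close>.\<close>

definition alive :: "'v list \<Rightarrow> 'v \<Rightarrow> bool" where
  "alive q w \<longleftrightarrow> \<not> killed q w \<and> ok w (Suc (length q))"

lemma piv_subset: "piv q \<subseteq> set q"
  by (induction q) auto

lemma piv_append_mono: "piv q \<subseteq> piv (p @ q)"
  by (induction p) auto

lemma killed_append: "killed q w \<Longrightarrow> killed (p @ q) w"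
  using piv_append_mono unfolding killed_def by blast

text \<open>A node processed at an admissible position becomes a pivot unless a pivot neighbour
  exists already; either way it is killed. Hence alive nodes still lie ahead in the order and are
  interchangeable.\<close>

lemma unkilled_notin: "\<not> killed q w \<Longrightarrow> ok w (length q) \<Longrightarrow> w \<notin> set q"
proof (induction q)
  case (Cons x q)
  have "\<not> killed q w" using Cons.prems(1) killed_append[of q w "[x]"] by auto
  moreover have "ok w (length q)" using Cons.prems(2) ok_antimono by fastforce
  ultimately have "w \<notin> set q" using Cons.IH by blast
  moreover have "w \<noteq> x"
  proof
    assume wx: "w = x"
    have "\<forall>u\<in>piv q. {u, x} \<notin> E"
      using \<open>\<not> killed q w\<close> wx unfolding killed_def by blast
    hence "x \<in> piv (x # q)" using Cons.prems(2) wx by simp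
    thus False using Cons.prems(1) wx unfolding killed_def by blast
  qed
  ultimately show ?case by simp
qed simp

lemma alive_notin: "alive q w \<Longrightarrow> w \<notin> set q"
  unfolding alive_def using unkilled_notin ok_antimono by (metis Suc_n_not_le_n nat_le_linear)

lemma alive_piv_Cons: "alive q u \<Longrightarrow> u \<in> piv (u # q)"
  unfolding alive_def killed_def by auto

lemma piv_append_iff:
  assumes "distinct (p @ q)" "u \<in> set q"
  shows "u \<in> piv (p @ q) \<longleftrightarrow> u \<in> piv q"
  using assms by (induction p) auto

definition prefix_before :: "'v list \<Rightarrow> 'v \<Rightarrow> 'v list" where
  "prefix_before xs u = takeWhile (\<lambda>w. w \<noteq> u) xs"

definition alive_at :: "'v list \<Rightarrow> 'v set \<Rightarrow> 'v \<Rightarrow> bool" where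
  "alive_at xs T u \<longleftrightarrow> (\<forall>w\<in>T. alive (rev (prefix_before xs u)) w)"

definition bad_triangle :: "'v set \<Rightarrow> bool" where
  "bad_triangle T \<longleftrightarrow> (\<exists>x y z. T = {x, y, z} \<and> x \<noteq> z \<and> {x, z} \<notin> E \<and> {x, y} \<in> E \<and> {y, z} \<in> E)"

abbreviation orders :: "'v list set" where
  "orders \<equiv> permutations_of_set V"

lemma prefix_before_split:
  assumes "u \<in> set xs"
  obtains q where "xs = prefix_before xs u @ u # q" "u \<notin> set (prefix_before xs u)"
proof -
  have "dropWhile (\<lambda>w. w \<noteq> u) xs \<noteq> []" using assms by (simp add: dropWhile_eq_Nil_conv)
  moreover have "hd (dropWhile (\<lambda>w. w \<noteq> u) xs) = u"
    using calculation hd_dropWhile by blast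
  ultimately obtain q where "dropWhile (\<lambda>w. w \<noteq> u) xs = u # q" by (cases "dropWhile (\<lambda>w. w \<noteq> u) xs") auto
  hence "xs = prefix_before xs u @ u # q"
    unfolding prefix_before_def by (metis takeWhile_dropWhile_id)
  moreover have "u \<notin> set (prefix_before xs u)" unfolding prefix_before_def by (auto dest: set_takeWhileD)
  ultimately show ?thesis using that by blast
qed

lemma bad_triangle_subset: "bad_triangle T \<Longrightarrow> T \<subseteq> V"
  unfolding bad_triangle_def using edgeD by blast

lemma bad_triangle_card: "bad_triangle T \<Longrightarrow> card T = 3"
  unfolding bad_triangle_def using edgeD by fastforce

lemma finite_bad_triangles: "finite {T. bad_triangle T}"
  by (rule finite_subset[of _ "Pow V"]) (use bad_triangle_subset finite_V in auto)

text \<open>Whichever node of the triangle becomes a pivot, it kills a second one as well. This is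
  what prevents two charges to one pair.\<close>

lemma bad_triangle_adjacent: "bad_triangle T \<Longrightarrow> u \<in> T \<Longrightarrow> \<exists>w\<in>T. {u, w} \<in> E \<and> w \<noteq> u"
  unfolding bad_triangle_def by (metis edgeD edge_sym insert_iff singletonD)

text \<open>If both positive edges are right, all three nodes share a cluster and the negative pair
  is wrong. The wrong pair is named by the opposite node \<open>u\<close>, the one whose hit would
  charge it.\<close>

lemma bad_triangle_error:
  assumes "bad_triangle T" "partition_on V Q"
  shows "\<exists>u\<in>T. T - {u} \<in> error_pairs V E Q"
proof -
  obtain x y z where T: "T = {x, y, z}" "x \<noteq> z" "{x, z} \<notin> E" "{x, y} \<in> E" "{y, z} \<in> E"
    using assms(1) unfolding bad_triangle_def by blast
  have ne: "x \<noteq> y" "y \<noteq> z" "x \<in> V" "y \<in> V" "z \<in> V" using T edgeD by blast+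
  have eqs: "T - {z} = {x, y}" "T - {x} = {y, z}" "T - {y} = {x, z}" using T ne by auto
  show ?thesis
  proof (rule ccontr)
    assume n: "\<not> ?thesis"
    have "{x, y} \<notin> error_pairs V E Q" "{y, z} \<notin> error_pairs V E Q" "{x, z} \<notin> error_pairs V E Q"
      using n T(1) eqs by (metis insertI1 insert_commute)+
    then obtain X Y where XY: "X \<in> Q" "{x, y} \<subseteq> X" "Y \<in> Q" "{y, z} \<subseteq> Y"
      using T by (auto simp: error_pairs_def)
    hence "X = Y" using assms(2) unfolding partition_on_def disjoint_def by blast
    hence "{x, z} \<in> error_pairs V E Q"
      using XY T ne by (auto simp: error_pairs_def)
    thus False using \<open>{x, z} \<notin> error_pairs V E Q\<close> by simp
  qed
qed

text \<open>Transposing \<open>u\<close> and \<open>u'\<close> leaves the prefix before \<open>u\<close> untouched, because nodes that are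
  still alive have not been processed yet.\<close>

lemma alive_at_transpose:
  assumes "xs \<in> orders" "u \<in> T" "u' \<in> T" "T \<subseteq> V" "alive_at xs T u"
  shows "alive_at (map (Transposition.transpose u u') xs) T u'"
proof -
  have "u \<in> set xs" using assms by (auto simp: permutations_of_set_def)
  then obtain q where q: "xs = prefix_before xs u @ u # q" by (rule prefix_before_split)
  let ?p = "prefix_before xs u"
  have nin: "u \<notin> set ?p" "u' \<notin> set ?p" using assms alive_notin unfolding alive_at_def by (metis set_rev)+
  have "map (Transposition.transpose u u') ?p = ?p"
    by (rule map_idI) (use nin in \<open>auto simp: Transposition.transpose_def\<close>)
  hence "map (Transposition.transpose u u') xs = ?p @ u' # map (Transposition.transpose u u') q"
    by (subst q) simp
  hence "prefix_before (map (Transposition.transpose u u') xs) u' = ?p"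
    using nin unfolding prefix_before_def by (simp add: takeWhile_append)
  thus ?thesis using assms(5) unfolding alive_at_def by simp
qed

lemma card_alive_at_le:
  assumes "u \<in> T" "u' \<in> T" "T \<subseteq> V"
  shows "card {xs \<in> orders. alive_at xs T u} \<le> card {xs \<in> orders. alive_at xs T u'}"
proof (rule card_inj_on_le)
  show "inj_on (map (Transposition.transpose u u')) {xs \<in> orders. alive_at xs T u}"
    by (intro inj_on_subset[OF inj_mapI] subset_UNIV) simp
  have "Transposition.transpose u u' ` V = V" using assms by (simp add: transpose_image_eq subsetD)
  hence "map (Transposition.transpose u u') xs \<in> orders" if "xs \<in> orders" for xs
    using that by (auto simp: permutations_of_set_def distinct_map)
  thus "map (Transposition.transpose u u') ` {xs \<in> orders. alive_at xs T u} \<subseteq> {xs \<in> orders. alive_at xs T u'}"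
    using alive_at_transpose assms by blast
qed (use finite_V in simp)

text \<open>If all of \<open>T\<close> is alive when \<open>u\<close> has its turn, \<open>u\<close>
  becomes a pivot, and its neighbours stay killed for every later turn.\<close>

lemma alive_at_kills:
  assumes "xs \<in> orders" "u \<in> set xs" "u' \<in> set xs" "rank xs u < rank xs u'"
    and "alive_at xs T u" "u \<in> T" "{u, w} \<in> E"
  shows "killed (rev (prefix_before xs u')) w"
proof -
  have d: "distinct xs" using assms(1) by (simp add: permutations_of_set_def)
  obtain q where q: "xs = prefix_before xs u @ u # q" "u \<notin> set (prefix_before xs u)"
    using prefix_before_split[OF assms(2)] .
  obtain q' where q': "xs = prefix_before xs u' @ u' # q'" "u' \<notin> set (prefix_before xs u')"
    using prefix_before_split[OF assms(3)] .
  have "u \<in> set (prefix_before xs u')"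
    using rank_less_iff_in_takeWhile[OF assms(3) d assms(2)] assms(4) by (simp add: prefix_before_def)
  then obtain a b where ab: "prefix_before xs u' = a @ u # b" by (meson split_list)
  hence "xs = a @ u # (b @ u' # q')" using q'(1) by simp
  moreover have "u \<notin> set a" using d calculation by auto
  ultimately have "a = prefix_before xs u"
    unfolding prefix_before_def by (simp add: takeWhile_append)
  hence r: "rev (prefix_before xs u') = rev b @ (u # rev (prefix_before xs u))"
    using ab by simp
  have "u \<in> piv (u # rev (prefix_before xs u))"
    using assms(5,6) alive_piv_Cons unfolding alive_at_def by blast
  hence "killed (u # rev (prefix_before xs u)) w" using assms(7) unfolding killed_def by blast
  thus ?thesis unfolding r by (rule killed_append)
qed

text \<open>Suppose \<open>u\<close> comes before \<open>u'\<close>. Then \<open>u\<close> kills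
  some node of the common pair, so \<open>T'\<close> is no longer whole at the turn of
  \<open>u'\<close>. Hence \<open>u\<close> and \<open>u'\<close> have the same rank and
  coincide.\<close>

lemma alive_at_unique:
  assumes "xs \<in> orders" "bad_triangle T" "bad_triangle T'" "u \<in> T" "u' \<in> T'" "T - {u} = T' - {u'}"
    and "alive_at xs T u" "alive_at xs T' u'"
  shows "T = T'"
proof -
  have sub: "T \<subseteq> V" "T' \<subseteq> V" using bad_triangle_subset assms by auto
  have aux: False if H: "bad_triangle T1" "u1 \<in> T1" "T1 \<subseteq> V" "u2 \<in> T2" "T2 \<subseteq> V" "T1 - {u1} = T2 - {u2}"
      "alive_at xs T1 u1" "alive_at xs T2 u2" "rank xs u1 < rank xs u2" for T1 T2 u1 u2
  proof -
    obtain w where w: "w \<in> T1" "{u1, w} \<in> E" "w \<noteq> u1" using bad_triangle_adjacent H by blast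
    have "w \<in> T2" using w H by blast
    moreover have "killed (rev (prefix_before xs u2)) w"
      by (rule alive_at_kills[OF assms(1) _ _ H(9,7,2) w(2)])
         (use H assms(1) in \<open>auto simp: permutations_of_set_def\<close>)
    ultimately show False using H(8) by (auto simp: alive_at_def alive_def)
  qed
  have "\<not> rank xs u < rank xs u'" "\<not> rank xs u' < rank xs u"
    using aux[of T u u' T'] aux[of T' u' u T] assms sub by auto
  hence "rank xs u = rank xs u'" by simp
  moreover have "u \<in> set xs" "u' \<in> set xs" using assms sub by (auto simp: permutations_of_set_def)
  ultimately have "u = u'" using rank_inj_on by (metis inj_onD)
  thus ?thesis using assms by (metis insert_Diff)
qed

text \<open>A triangle hit at \<open>u\<close> charges the opposite pair. That is the pair the new
  pivot gets wrong: it either joins a negative pair or takes away one end of a positive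
  edge.\<close>

definition charged :: "'v list \<Rightarrow> 'v set set" where
  "charged xs = {T - {u} |T u. bad_triangle T \<and> u \<in> T \<and> alive_at xs T u}"

lemma card_charged_le:
  "card (charged xs) \<le> (\<Sum>T | bad_triangle T. \<Sum>u\<in>T. if alive_at xs T u then 1 else 0)"
proof -
  let ?S = "SIGMA T:{T. bad_triangle T}. {u \<in> T. alive_at xs T u}"
  have fT: "finite T" if "bad_triangle T" for T using that bad_triangle_subset finite_V finite_subset by blast
  have fin: "finite ?S" by (rule finite_SigmaI) (use finite_bad_triangles fT in auto)
  have "charged xs \<subseteq> (\<lambda>(T, u). T - {u}) ` ?S" unfolding charged_def by force
  hence "card (charged xs) \<le> card ?S" using fin by (rule surj_card_le[rotated])
  also have "\<dots> = (\<Sum>T | bad_triangle T. card {u \<in> T. alive_at xs T u})"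
    by (rule card_SigmaI) (use finite_bad_triangles fT in auto)
  also have "\<dots> = (\<Sum>T | bad_triangle T. \<Sum>u\<in>T. if alive_at xs T u then 1 else 0)"
    by (intro sum.cong refl) (use fT in \<open>simp add: sum.If_cases Collect_conj_eq\<close>)
  finally show ?thesis .
qed

text \<open>The fractional packing of bad triangles by the probabilities that they are hit while alive
  is a lower bound on the optimum: each triangle is paid for by one pair on which the optimum
  errs, and in a fixed order a pair pays for at most one triangle.\<close>

lemma sum_card_charged_le: "(\<Sum>xs\<in>orders. card (charged xs)) \<le> 3 * (card orders * OPT V E)"
proof -
  obtain Q where Q: "partition_on V Q" "clustering_cost V E Q = OPT V E"
    using OPT_attained[OF finite_V] by blast
  define h where "h T = (SOME u. u \<in> T \<and> T - {u} \<in> error_pairs V E Q)" for T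
  have h: "h T \<in> T \<and> T - {h T} \<in> error_pairs V E Q" if "bad_triangle T" for T
    unfolding h_def by (rule someI_ex) (use bad_triangle_error[OF that Q(1)] in blast)
  let ?B = "{T. bad_triangle T}"
  have fo: "finite orders" using finite_V by simp
  have "(\<Sum>xs\<in>orders. card (charged xs)) \<le> (\<Sum>xs\<in>orders. \<Sum>T\<in>?B. \<Sum>u\<in>T. if alive_at xs T u then 1 else 0)"
    by (intro sum_mono card_charged_le)
  also have "\<dots> = (\<Sum>T\<in>?B. \<Sum>u\<in>T. \<Sum>xs\<in>orders. if alive_at xs T u then 1 else 0)"
    by (subst sum.swap, intro sum.cong refl, rule sum.swap)
  also have "\<dots> = (\<Sum>T\<in>?B. \<Sum>u\<in>T. card {xs \<in> orders. alive_at xs T u})"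
    by (intro sum.cong refl) (use fo in \<open>simp add: sum.If_cases Collect_conj_eq\<close>)
  \<comment> \<open>By symmetry all three hits of \<open>T\<close> are moved to the node
    \<open>h T\<close> opposite a pair on which the optimum errs; this is the origin of the factor
    3.\<close>
  also have "\<dots> \<le> (\<Sum>T\<in>?B. \<Sum>u\<in>T. card {xs \<in> orders. alive_at xs T (h T)})"
    by (intro sum_mono card_alive_at_le) (use h bad_triangle_subset in auto)
  also have "\<dots> = 3 * (\<Sum>T\<in>?B. card {xs \<in> orders. alive_at xs T (h T)})"
    by (simp add: bad_triangle_card sum_distrib_left)
  also have "(\<Sum>T\<in>?B. card {xs \<in> orders. alive_at xs T (h T)}) =
      (\<Sum>T\<in>?B. \<Sum>xs\<in>orders. if alive_at xs T (h T) then 1 else 0)"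
    by (intro sum.cong refl) (use fo in \<open>simp add: sum.If_cases Collect_conj_eq\<close>)
  also have "\<dots> = (\<Sum>xs\<in>orders. \<Sum>T\<in>?B. if alive_at xs T (h T) then 1 else 0)"
    by (rule sum.swap)
  also have "\<dots> = (\<Sum>xs\<in>orders. card {T \<in> ?B. alive_at xs T (h T)})"
    by (intro sum.cong refl) (use finite_bad_triangles in \<open>simp add: sum.If_cases Collect_conj_eq\<close>)
  also have "\<dots> \<le> (\<Sum>xs\<in>orders. OPT V E)"
  proof (rule sum_mono)
    fix xs assume xs: "xs \<in> orders"
    have "card {T \<in> ?B. alive_at xs T (h T)} \<le> card (error_pairs V E Q)"
    proof (rule card_inj_on_le)
      show "inj_on (\<lambda>T. T - {h T}) {T \<in> ?B. alive_at xs T (h T)}"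
        by (rule inj_onI) (use alive_at_unique[OF xs] h in blast)
    qed (use h finite_error_pairs[OF graph] in auto)
    thus "card {T \<in> ?B. alive_at xs T (h T)} \<le> OPT V E"
      using Q(2) clustering_cost_eq_card_error_pairs[OF graph] by simp
  qed
  finally show ?thesis by simp
qed

end

section \<open>Cost of the truncation\<close>

context truncated_pivot begin

lemma order_props:
  assumes "xs \<in> orders"
  shows "distinct xs" "set xs = V" "length xs = card V"
  using assms by (auto simp: permutations_of_set_def distinct_card[symmetric])

text \<open>The status of a node is settled at its own turn. This translates statements about
  prefixes into statements about ranks of the final pivots.\<close>

lemma piv_take:
  assumes "xs \<in> orders"
  shows "piv (rev (take k xs)) = {u \<in> piv (rev xs). rank xs u \<le> k}"
proof -
  have r: "rev xs = rev (drop k xs) @ rev (take k xs)"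
    by (metis append_take_drop_id rev_append)
  have "u \<in> piv (rev (take k xs)) \<longleftrightarrow> u \<in> piv (rev xs) \<and> rank xs u \<le> k" for u
  proof (cases "u \<in> set (take k xs)")
    case True
    hence "u \<in> piv (rev xs) \<longleftrightarrow> u \<in> piv (rev (take k xs))"
      unfolding r by (intro piv_append_iff) (use order_props[OF assms] r in \<open>auto simp del: rev_append simp flip: r\<close>)
    moreover have "rank xs u \<le> k"
      using True rank_le_iff_in_take[OF order_props(1)[OF assms]] by (meson in_set_takeD)
    ultimately show ?thesis by blast
  next
    case False
    hence "u \<notin> piv (rev (take k xs))" using piv_subset by (metis set_rev subsetD)
    moreover have "\<not> rank xs u \<le> k" if "u \<in> piv (rev xs)"
      using that False rank_le_iff_in_take[OF order_props(1)[OF assms]] piv_subset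
      by (metis set_rev subsetD)
    ultimately show ?thesis by blast
  qed
  thus ?thesis by blast
qed

lemma piv_in_V: "xs \<in> orders \<Longrightarrow> u \<in> piv (rev xs) \<Longrightarrow> u \<in> V \<and> u \<in> set xs"
  using piv_subset order_props(2) by (metis set_rev subsetD)

lemma alive_before_iff:
  assumes "xs \<in> orders"
  shows "alive (rev (prefix_before xs u)) w \<longleftrightarrow>
    (\<forall>x\<in>piv (rev xs). rank xs x < rank xs u \<longrightarrow> x \<noteq> w \<and> {x, w} \<notin> E) \<and> ok w (rank xs u)"
proof -
  have "prefix_before xs u = take (rank xs u - 1) xs"
    unfolding prefix_before_def rank_def by (metis add_diff_cancel_right' takeWhile_eq_take)
  moreover have "rank xs x \<le> rank xs u - 1 \<longleftrightarrow> rank xs x < rank xs u" for x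
    unfolding rank_def by linarith
  ultimately have "piv (rev (prefix_before xs u)) = {x \<in> piv (rev xs). rank xs x < rank xs u}"
    using piv_take[OF assms, of "rank xs u - 1"] by simp
  moreover have "Suc (length (prefix_before xs u)) = rank xs u"
    by (simp add: prefix_before_def rank_def)
  ultimately show ?thesis unfolding alive_def killed_def by auto
qed

lemma mem_piv_iff_alive:
  assumes "xs \<in> orders" "u \<in> V"
  shows "u \<in> piv (rev xs) \<longleftrightarrow> alive (rev (prefix_before xs u)) u"
proof -
  have us: "u \<in> set xs" using assms order_props by blast
  obtain q where q: "xs = prefix_before xs u @ u # q" "u \<notin> set (prefix_before xs u)"
    using prefix_before_split[OF us] .
  let ?p = "prefix_before xs u"
  have r: "rev xs = rev q @ (u # rev ?p)" by (subst q(1)) simp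
  have "u \<in> piv (rev xs) \<longleftrightarrow> u \<in> piv (u # rev ?p)"
    unfolding r by (rule piv_append_iff) (use order_props(1)[OF assms(1)] r in \<open>auto simp flip: r\<close>)
  also have "\<dots> \<longleftrightarrow> alive (rev ?p) u"
    using piv_subset[of "rev ?p"] q(2) unfolding alive_def killed_def by auto
  finally show ?thesis .
qed

text \<open>The rule of \<open>cluster_label\<close> with adjacency in \<open>E\<close> instead of
  the stored edges and \<open>piv\<close> instead of \<open>pivots\<close>; the two rules agree when
  the strings have enough leading zeros.\<close>

definition label :: "'v list \<Rightarrow> 'v \<Rightarrow> 'v" where
  "label xs v =
     (let M = piv (rev xs);
          N = {u \<in> M. {u, v} \<in> E};
          u = arg_min_on (rank xs) N
      in if v \<notin> M \<and> N \<noteq> {} \<and> ok v (rank xs u) then u else v)"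

definition clusters :: "'v list \<Rightarrow> 'v set set" where
  "clusters xs = (\<lambda>v. {w \<in> V. label xs w = label xs v}) ` V"

lemma same_cluster_iff:
  "v \<in> V \<Longrightarrow> w \<in> V \<Longrightarrow> (\<exists>X\<in>clusters xs. {v, w} \<subseteq> X) \<longleftrightarrow> label xs v = label xs w"
  unfolding clusters_def by auto

lemma finite_piv: "finite (piv q)"
  using piv_subset finite_subset by blast

lemma label_cases:
  assumes "label xs v \<noteq> v"
  shows "label xs v \<in> piv (rev xs)" "{label xs v, v} \<in> E" "v \<notin> piv (rev xs)" "ok v (rank xs (label xs v))"
    "x \<in> piv (rev xs) \<Longrightarrow> {x, v} \<in> E \<Longrightarrow> rank xs (label xs v) \<le> rank xs x"
proof -
  let ?N = "{u \<in> piv (rev xs). {u, v} \<in> E}"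
  have c: "v \<notin> piv (rev xs)" "?N \<noteq> {}" "ok v (rank xs (arg_min_on (rank xs) ?N))"
    and l: "label xs v = arg_min_on (rank xs) ?N"
    using assms unfolding label_def Let_def by (auto split: if_splits)
  have f: "finite ?N" using finite_piv by simp
  show "v \<notin> piv (rev xs)" "ok v (rank xs (label xs v))" using c l by auto
  have "label xs v \<in> ?N" using arg_min_if_finite(1)[OF f c(2)] l by simp
  thus "label xs v \<in> piv (rev xs)" "{label xs v, v} \<in> E" by auto
  show "x \<in> piv (rev xs) \<Longrightarrow> {x, v} \<in> E \<Longrightarrow> rank xs (label xs v) \<le> rank xs x"
    using arg_min_if_finite(2)[OF f c(2), of "rank xs"] l by (metis (mono_tags, lifting) mem_Collect_eq not_less)
qed

lemma label_pivot: "u \<in> piv (rev xs) \<Longrightarrow> label xs u = u"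
  using label_cases(3) by blast

lemma pivot_later_not_pivot:
  assumes "xs \<in> orders" "u \<in> piv (rev xs)" "{u, v} \<in> E" "alive (rev (prefix_before xs u)) v"
  shows "v \<notin> piv (rev xs)"
proof
  assume v: "v \<in> piv (rev xs)"
  have ne: "u \<noteq> v" "u \<in> V" "v \<in> V" using edgeD assms by blast+
  have "\<not> rank xs v < rank xs u" using assms(4) v alive_before_iff[OF assms(1)] by blast
  moreover have "rank xs v \<noteq> rank xs u"
    using ne rank_inj_on order_props(2)[OF assms(1)] by (metis inj_onD)
  ultimately have "rank xs u < rank xs v" by simp
  thus False using v mem_piv_iff_alive[OF assms(1) ne(3)] alive_before_iff[OF assms(1)] assms by blast
qed

text \<open>That \<open>v\<close> is alive at the turn of \<open>u\<close> excludes every earlier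
  pivot neighbour, so \<open>u\<close> attains the minimum, and it also supplies the threshold test
  for \<open>v\<close>.\<close>

lemma label_first_pivot:
  assumes "xs \<in> orders" "u \<in> piv (rev xs)" "{u, v} \<in> E" "alive (rev (prefix_before xs u)) v"
  shows "label xs v = u"
proof -
  let ?N = "{u \<in> piv (rev xs). {u, v} \<in> E}"
  have f: "finite ?N" and ne: "?N \<noteq> {}" using finite_piv assms by auto
  let ?u = "arg_min_on (rank xs) ?N"
  have u: "?u \<in> ?N" using arg_min_if_finite(1)[OF f ne] .
  have "\<not> rank xs u < rank xs ?u" using arg_min_if_finite(2)[OF f ne, of "rank xs"] assms(2,3) by blast
  moreover have "\<not> rank xs ?u < rank xs u"
    using assms(4) u alive_before_iff[OF assms(1)] by blast
  ultimately have "rank xs ?u = rank xs u" by simp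
  hence eq: "?u = u"
    using rank_inj_on u assms(1,2) piv_in_V by (metis (no_types, lifting) inj_onD mem_Collect_eq)
  have "ok v (rank xs u)" using assms(4) alive_before_iff[OF assms(1)] by blast
  thus ?thesis using eq ne pivot_later_not_pivot[OF assms] unfolding label_def Let_def by simp
qed

definition truncated :: "'v list \<Rightarrow> 'v set" where
  "truncated xs = {v \<in> V. \<forall>u\<in>piv (rev xs). ok v (rank xs u) \<longrightarrow> u \<noteq> v \<and> {u, v} \<notin> E}"

text \<open>Survival of \<open>w\<close> is measured at the threshold of \<open>v\<close>. As
  \<open>w\<close> has no larger degree, its own threshold is no earlier, so up to that time it
  could have become a pivot and killed \<open>v\<close>. The degree condition assigns an edge to its
  endpoint of larger degree.\<close>

definition late_nbrs :: "'v list \<Rightarrow> 'v \<Rightarrow> 'v set" where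
  "late_nbrs xs v = {w. {v, w} \<in> E \<and> vdeg E w \<le> vdeg E v \<and>
     (\<forall>u\<in>piv (rev xs). ok v (rank xs u) \<longrightarrow> u \<noteq> w \<and> {u, w} \<notin> E)}"

lemma charged_triangleI:
  assumes "xs \<in> orders" "u \<in> piv (rev xs)" "bad_triangle {u, v, w}" "u \<noteq> v" "u \<noteq> w"
    and "alive (rev (prefix_before xs u)) v" "alive (rev (prefix_before xs u)) w"
  shows "{v, w} \<in> charged xs"
proof -
  have "u \<in> V" using piv_in_V assms by blast
  hence "alive (rev (prefix_before xs u)) u" using mem_piv_iff_alive assms by blast
  hence "alive_at xs {u, v, w} u" using assms unfolding alive_at_def by blast
  moreover have "{u, v, w} - {u} = {v, w}" using assms by blast
  ultimately show ?thesis using assms(3) unfolding charged_def by blast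
qed

text \<open>The common label is neither \<open>v\<close> nor \<open>w\<close>, since a node only
  takes the label of itself or a neighbour. It is therefore a pivot adjacent to both and the first
  such for each, so the bad triangle is whole at its turn.\<close>

lemma negative_error_charged:
  assumes "xs \<in> orders" "v \<noteq> w" "{v, w} \<notin> E" "label xs v = label xs w"
  shows "{v, w} \<in> charged xs"
proof -
  let ?u = "label xs v"
  have "?u \<noteq> v" using assms label_cases(2)[of xs w] by auto
  moreover have "?u \<noteq> w" using assms label_cases(2)[of xs v] by (auto simp: insert_commute)
  ultimately have v: "label xs v \<noteq> v" and w: "label xs w \<noteq> w" using assms by auto
  show ?thesis
  proof (rule charged_triangleI[OF assms(1) label_cases(1)[OF v]])
    show "bad_triangle {?u, v, w}" unfolding bad_triangle_def
      by (rule exI[of _ v], rule exI[of _ ?u], rule exI[of _ w])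
         (use label_cases(2)[OF v] label_cases(2)[OF w] assms in \<open>auto simp: insert_commute\<close>)
    show "alive (rev (prefix_before xs ?u)) v"
      using alive_before_iff[OF assms(1)] label_cases[OF v] by (metis leD)
    show "alive (rev (prefix_before xs ?u)) w"
      using alive_before_iff[OF assms(1)] label_cases[OF w] assms(4) by (metis leD)
  qed (use v w assms in auto)
qed

text \<open>Take the first pivot \<open>u\<close> within the threshold of \<open>v\<close> that
  touches \<open>v\<close> or \<open>w\<close>. If there is none, the truncation is to blame.
  Otherwise both ends are alive at its turn; being one of them or adjacent to both would give equal
  labels, so \<open>u\<close> is adjacent to exactly one and completes a bad triangle.\<close>

lemma positive_error_cases:
  assumes "xs \<in> orders" "{v, w} \<in> E" "label xs v \<noteq> label xs w" "vdeg E w \<le> vdeg E v"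
  shows "{v, w} \<in> charged xs \<or> (v \<in> truncated xs \<and> w \<in> late_nbrs xs v)"
proof -
  let ?M = "piv (rev xs)"
  \<comment> \<open>Only the threshold of \<open>v\<close> is imposed; by the degree hypothesis it
    implies that of \<open>w\<close>.\<close>
  define K where "K = {u \<in> ?M. (u = v \<or> u = w \<or> {u, v} \<in> E \<or> {u, w} \<in> E) \<and> ok v (rank xs u)}"
  have vw: "v \<noteq> w" "v \<in> V" "w \<in> V" using edgeD assms(2) by blast+
  show ?thesis
  proof (cases "K = {}")
    case True
    thus ?thesis using assms vw unfolding K_def truncated_def late_nbrs_def by blast
  next
    case False
    have fK: "finite K" unfolding K_def using finite_piv by simp
    define u where "u = arg_min_on (rank xs) K"
    have u: "u \<in> K" unfolding u_def using arg_min_if_finite(1)[OF fK False] .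
    have umin: "\<not> rank xs x < rank xs u" if "x \<in> K" for x
      using arg_min_if_finite(2)[OF fK False, of "rank xs"] that unfolding u_def by blast
    have uM: "u \<in> ?M" and okv: "ok v (rank xs u)" using u unfolding K_def by auto
    have okw: "ok w (rank xs u)" using ok_degree[OF assms(4) okv] .
    have before: "x \<noteq> v \<and> {x, v} \<notin> E \<and> x \<noteq> w \<and> {x, w} \<notin> E" if "x \<in> ?M" "rank xs x < rank xs u" for x
    proof -
      have "ok v (rank xs x)" using okv ok_antimono that by (meson less_imp_le)
      thus ?thesis using umin[of x] that unfolding K_def by blast
    qed
    have av: "alive (rev (prefix_before xs u)) v" and aw: "alive (rev (prefix_before xs u)) w"
      using alive_before_iff[OF assms(1)] before okv okw by auto
    have uv: "u \<noteq> v"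
    proof
      assume uv: "u = v"
      have "label xs w = v" using label_first_pivot[OF assms(1) uM _ aw] assms(2) uv by blast
      thus False using label_pivot uM uv assms(3) by metis
    qed
    have uw: "u \<noteq> w"
    proof
      assume uw: "u = w"
      have "label xs v = w" using label_first_pivot[OF assms(1) uM _ av] assms(2) uw by (metis edge_sym)
      thus False using label_pivot uM uw assms(3) by metis
    qed
    have "\<not> ({u, v} \<in> E \<and> {u, w} \<in> E)"
      using label_first_pivot[OF assms(1) uM _ av] label_first_pivot[OF assms(1) uM _ aw] assms(3) by auto
    moreover have "{u, v} \<in> E \<or> {u, w} \<in> E" using u uv uw unfolding K_def by blast
    ultimately consider "{u, v} \<in> E" "{u, w} \<notin> E" | "{u, w} \<in> E" "{u, v} \<notin> E" by blast
    hence "bad_triangle {u, v, w}"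
    proof cases
      case 1
      thus ?thesis unfolding bad_triangle_def
        by (intro exI[of _ u] exI[of _ v] exI[of _ w]) (use assms uw in auto)
    next
      case 2
      thus ?thesis unfolding bad_triangle_def
        by (intro exI[of _ u] exI[of _ w] exI[of _ v]) (use assms uv in \<open>auto simp: insert_commute\<close>)
    qed
    thus ?thesis using charged_triangleI[OF assms(1) uM _ uv uw av aw] by blast
  qed
qed

lemma error_pairs_clusters_subset:
  assumes "xs \<in> orders"
  shows "error_pairs V E (clusters xs) \<subseteq>
    charged xs \<union> (\<Union>v\<in>truncated xs. (\<lambda>w. {v, w}) ` late_nbrs xs v)"
proof
  fix e assume e: "e \<in> error_pairs V E (clusters xs)"
  have "e \<subseteq> V" "card e = 2" using e graph unfolding error_pairs_def simple_graph_def by auto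
  then obtain v w where vw: "e = {v, w}" "v \<noteq> w" "v \<in> V" "w \<in> V" by (auto simp: card_2_iff)
  show "e \<in> charged xs \<union> (\<Union>v\<in>truncated xs. (\<lambda>w. {v, w}) ` late_nbrs xs v)"
  proof (cases "e \<in> E")
    case False
    hence "label xs v = label xs w"
      using e same_cluster_iff[OF vw(3,4), of xs] vw(1) by (auto simp: error_pairs_def)
    thus ?thesis using negative_error_charged[OF assms vw(2)] False vw(1) by blast
  next
    case True
    hence "label xs v \<noteq> label xs w"
      using e same_cluster_iff[OF vw(3,4), of xs] vw(1) by (auto simp: error_pairs_def)
    thus ?thesis
      using positive_error_cases[OF assms, of v w] positive_error_cases[OF assms, of w v] True vw(1)
      by (cases "vdeg E w \<le> vdeg E v") (auto simp: insert_commute)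
  qed
qed

text \<open>A truncated node keeps its own label and, not being a pivot, passes it to no other
  node.\<close>

lemma truncated_edges_cut:
  assumes "xs \<in> orders" "v \<in> truncated xs" "e \<in> E" "v \<in> e"
  shows "e \<in> error_pairs V E (clusters xs)"
proof -
  obtain a b where "e = {a, b}" "a \<noteq> b" "a \<in> V" "b \<in> V" by (rule edge_cases[OF assms(3)])
  then obtain w where w: "e = {v, w}" "v \<noteq> w" "v \<in> V" "w \<in> V" using assms(4) by blast
  have vM: "v \<notin> piv (rev xs)"
  proof
    assume v: "v \<in> piv (rev xs)"
    hence "ok v (rank xs v)" using mem_piv_iff_alive[OF assms(1) w(3)] alive_before_iff[OF assms(1)] by blast
    thus False using v assms(2) unfolding truncated_def by blast
  qed
  have "label xs v = v"
    using label_cases(1,2,4)[of xs v] assms(2) unfolding truncated_def by blast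
  moreover have "label xs w \<noteq> v" using label_cases(1)[of xs w] vM w by metis
  ultimately have "\<not> (\<exists>X\<in>clusters xs. {v, w} \<subseteq> X)" using same_cluster_iff[OF w(3,4)] by metis
  thus ?thesis using assms(3) w(1) unfolding error_pairs_def by blast
qed

text \<open>Double counting: every edge at a truncated node is an error, and an error has two
  endpoints.\<close>

lemma sum_vdeg_truncated_le:
  assumes "xs \<in> orders"
  shows "(\<Sum>v\<in>truncated xs. vdeg E v) \<le> 2 * clustering_cost V E (clusters xs)"
proof -
  let ?R = "error_pairs V E (clusters xs)"
  have fR: "finite ?R" using finite_error_pairs[OF graph] .
  have ft: "finite (truncated xs)" using finite_V unfolding truncated_def by simp
  have "(\<Sum>v\<in>truncated xs. vdeg E v) \<le> (\<Sum>v\<in>truncated xs. card {e \<in> ?R. v \<in> e})"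
    unfolding vdeg_def by (intro sum_mono card_mono) (use fR truncated_edges_cut[OF assms] in auto)
  also have "\<dots> = (\<Sum>v\<in>truncated xs. \<Sum>e\<in>?R. if v \<in> e then 1 else 0)"
    by (intro sum.cong refl) (use fR in \<open>simp add: sum.If_cases Collect_conj_eq\<close>)
  also have "\<dots> = (\<Sum>e\<in>?R. \<Sum>v\<in>truncated xs. if v \<in> e then 1 else 0)" by (rule sum.swap)
  also have "\<dots> \<le> (\<Sum>e\<in>?R. 2)"
  proof (rule sum_mono)
    fix e assume "e \<in> ?R"
    hence c: "card e = 2" using graph unfolding error_pairs_def simple_graph_def by auto
    have "(\<Sum>v\<in>truncated xs. if v \<in> e then 1 else 0) = card (truncated xs \<inter> e)"
      using ft by (simp add: sum.If_cases)
    also have "\<dots> \<le> card e" by (rule card_mono) (use c card.infinite in fastforce)+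
    finally show "(\<Sum>v\<in>truncated xs. if v \<in> e then 1 else 0) \<le> (2 :: nat)" using c by simp
  qed
  finally show ?thesis using clustering_cost_eq_card_error_pairs[OF graph] by simp
qed

lemma finite_late_nbrs: "finite (late_nbrs xs v)"
  by (rule finite_subset[OF _ finite_V]) (use edgeD in \<open>auto simp: late_nbrs_def\<close>)

lemma finite_charged: "finite (charged xs)"
proof (rule finite_subset)
  show "charged xs \<subseteq> Pow V" unfolding charged_def using bad_triangle_subset by blast
qed (use finite_V in simp)

text \<open>Truncated nodes become singletons, so all their edges are cut; the few edges cut only
  because of the truncation are charged to the others.\<close>

lemma cost_clusters_le:
  assumes "xs \<in> orders" "\<eta> \<ge> 0"
    and late: "\<And>v. v \<in> truncated xs \<Longrightarrow> real (card (late_nbrs xs v)) \<le> \<eta> * real (vdeg E v)"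
  shows "(1 - 2 * \<eta>) * real (clustering_cost V E (clusters xs)) \<le> real (card (charged xs))"
proof -
  let ?c = "clustering_cost V E (clusters xs)"
  have ft: "finite (truncated xs)" using finite_V unfolding truncated_def by simp
  have "card (error_pairs V E (clusters xs)) \<le>
      card (charged xs \<union> (\<Union>v\<in>truncated xs. (\<lambda>w. {v, w}) ` late_nbrs xs v))"
    by (rule card_mono) (use error_pairs_clusters_subset[OF assms(1)] finite_charged ft finite_late_nbrs in auto)
  also have "\<dots> \<le> card (charged xs) + card (\<Union>v\<in>truncated xs. (\<lambda>w. {v, w}) ` late_nbrs xs v)"
    by (rule card_Un_le)
  also have "card (\<Union>v\<in>truncated xs. (\<lambda>w. {v, w}) ` late_nbrs xs v) \<le>
      (\<Sum>v\<in>truncated xs. card ((\<lambda>w. {v, w}) ` late_nbrs xs v))"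
    by (rule card_UN_le[OF ft])
  also have "\<dots> \<le> (\<Sum>v\<in>truncated xs. card (late_nbrs xs v))"
    by (intro sum_mono card_image_le finite_late_nbrs)
  finally have "?c \<le> card (charged xs) + (\<Sum>v\<in>truncated xs. card (late_nbrs xs v))"
    using clustering_cost_eq_card_error_pairs[OF graph] by simp
  hence "real ?c \<le> real (card (charged xs)) + (\<Sum>v\<in>truncated xs. real (card (late_nbrs xs v)))"
    by (metis of_nat_add of_nat_le_iff of_nat_sum)
  also have "(\<Sum>v\<in>truncated xs. real (card (late_nbrs xs v))) \<le> (\<Sum>v\<in>truncated xs. \<eta> * real (vdeg E v))"
    by (intro sum_mono late)
  also have "\<dots> = \<eta> * real (\<Sum>v\<in>truncated xs. vdeg E v)" by (simp add: sum_distrib_left)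
  also have "\<dots> \<le> \<eta> * real (2 * ?c)"
    by (intro mult_left_mono) (use sum_vdeg_truncated_le[OF assms(1)] assms(2) of_nat_mono in blast)+
  finally show ?thesis by (simp add: algebra_simps)
qed

text \<open>A node admissible at every position is a pivot or has an earlier pivot neighbour,
  necessarily within its threshold. So truncation concerns only thresholds that bind within the
  order.\<close>

lemma truncated_not_ok:
  assumes "xs \<in> orders" "v \<in> truncated xs"
  shows "\<not> ok v (card V)"
proof
  assume ok: "ok v (card V)"
  have v: "v \<in> V" using assms unfolding truncated_def by blast
  have okr: "ok v (rank xs v)"
    using ok ok_antimono rank_le_length[of v xs] order_props[OF assms(1)] v by metis
  have "v \<notin> piv (rev xs)" using okr assms(2) unfolding truncated_def by blast
  then obtain x where "x \<in> piv (rev xs)" "rank xs x < rank xs v" "x = v \<or> {x, v} \<in> E"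
    using mem_piv_iff_alive[OF assms(1) v] alive_before_iff[OF assms(1)] okr by blast
  moreover have "ok v (rank xs x)" using okr ok_antimono calculation by (meson less_imp_le)
  ultimately show False using assms(2) unfolding truncated_def by blast
qed

end

text \<open>With \<open>q\<close> already placed, newest first, the next node is uniform on the
  remaining set \<open>A\<close>. At least \<open>\<delta>\<close> choices spoil
  \<open>Good\<close>, so each step survives with probability at most
  \<open>1 - \<delta> / card A\<close>, which is at most \<open>1 - \<delta> / card V\<close>.
  Stated by counting, with induction on the number of steps.\<close>

lemma card_prefix_survival_le:
  fixes Good :: "'a list \<Rightarrow> bool" and \<delta> :: real
  assumes "finite V" "0 \<le> \<delta>" "\<delta> \<le> real (card V)"
    and step: "\<And>q. length q < k \<Longrightarrow> distinct q \<Longrightarrow> set q \<subseteq> V \<Longrightarrow> Good q \<Longrightarrow>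
      \<delta> \<le> real (card {x \<in> V - set q. \<not> Good (x # q)})"
    and "set q \<inter> A = {}" "set q \<union> A = V" "distinct q" "length q + m \<le> k" "m \<le> card A"
  shows "real (card {ys \<in> permutations_of_set A. \<forall>i\<le>m. Good (rev (take i ys) @ q)}) \<le>
    (1 - \<delta> / real (card V)) ^ m * fact (card A)"
  using assms(5-)
proof (induction m arbitrary: q A)
  case 0
  have "finite A" using 0 assms(1) by auto
  have "card {ys \<in> permutations_of_set A. \<forall>i\<le>0. Good (rev (take i ys) @ q)} \<le> card (permutations_of_set A)"
    by (rule card_mono) auto
  also have "\<dots> = fact (card A)" using \<open>finite A\<close> by simp
  finally show ?case by (simp add: of_nat_le_iff[symmetric, where ?'a = real] del: of_nat_le_iff)
next
  case (Suc m)
  let ?\<rho> = "1 - \<delta> / real (card V)"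
  have fA: "finite A" using Suc.prems assms(1) by auto
  have neA: "A \<noteq> {}" using Suc.prems by auto
  have Vpos: "card V > 0" using neA Suc.prems assms(1) by (auto simp: card_gt_0_iff)
  have rho: "0 \<le> ?\<rho>" using assms(3) Vpos by simp
  show ?case
  proof (cases "Good q")
    case False
    hence empty: "{ys \<in> permutations_of_set A. \<forall>i\<le>Suc m. Good (rev (take i ys) @ q)} = {}" by force
    show ?thesis unfolding empty using rho by simp
  next
    case True
    let ?X = "{x \<in> A. Good (x # q)}"
    let ?S = "\<lambda>x. {ys \<in> permutations_of_set (A - {x}). \<forall>i\<le>m. Good (rev (take i ys) @ (x # q))}"
    have sub: "{ys \<in> permutations_of_set A. \<forall>i\<le>Suc m. Good (rev (take i ys) @ q)} \<subseteq> (\<Union>x\<in>?X. (#) x ` ?S x)"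
    proof
      fix ys assume ys: "ys \<in> {ys \<in> permutations_of_set A. \<forall>i\<le>Suc m. Good (rev (take i ys) @ q)}"
      hence "ys \<in> (\<Union>x\<in>A. (#) x ` permutations_of_set (A - {x}))"
        using permutations_of_set_nonempty[OF neA] by auto
      then obtain x zs where x: "x \<in> A" "ys = x # zs" "zs \<in> permutations_of_set (A - {x})" by auto
      have g: "Good (rev (take i ys) @ q)" if "i \<le> Suc m" for i using ys that by blast
      have "Good (x # q)" using g[of 1] x by simp
      moreover have "Good (rev (take i zs) @ (x # q))" if "i \<le> m" for i
        using g[of "Suc i"] x that by simp
      ultimately show "ys \<in> (\<Union>x\<in>?X. (#) x ` ?S x)" using x by blast
    qed
    have IH: "real (card (?S x)) \<le> ?\<rho> ^ m * fact (card A - 1)" if "x \<in> A" for x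
    proof -
      have "card (A - {x}) = card A - 1" using that fA by simp
      moreover have "set (x # q) \<inter> (A - {x}) = {}" "set (x # q) \<union> (A - {x}) = V" "distinct (x # q)"
        "length (x # q) + m \<le> k" "m \<le> card (A - {x})"
        using Suc.prems that fA by auto
      ultimately show ?thesis using Suc.IH[of "x # q" "A - {x}"] by simp
    qed
    have "card {ys \<in> permutations_of_set A. \<forall>i\<le>Suc m. Good (rev (take i ys) @ q)} \<le> card (\<Union>x\<in>?X. (#) x ` ?S x)"
      by (rule card_mono[OF _ sub]) (use fA in auto)
    also have "\<dots> \<le> (\<Sum>x\<in>?X. card ((#) x ` ?S x))" by (rule card_UN_le) (use fA in auto)
    also have "\<dots> = (\<Sum>x\<in>?X. card (?S x))" by (intro sum.cong refl card_image) auto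
    finally have "real (card {ys \<in> permutations_of_set A. \<forall>i\<le>Suc m. Good (rev (take i ys) @ q)})
        \<le> (\<Sum>x\<in>?X. real (card (?S x)))" by (simp only: of_nat_sum[symmetric] of_nat_le_iff)
    also have "\<dots> \<le> (\<Sum>x\<in>?X. ?\<rho> ^ m * fact (card A - 1))" by (intro sum_mono IH) auto
    also have "\<dots> = real (card ?X) * (?\<rho> ^ m * fact (card A - 1))" by simp
    also have "\<dots> \<le> (?\<rho> * real (card A)) * (?\<rho> ^ m * fact (card A - 1))"
    proof (rule mult_right_mono)
      have "\<delta> \<le> real (card {x \<in> V - set q. \<not> Good (x # q)})"
        by (rule step) (use Suc.prems True in auto)
      also have "{x \<in> V - set q. \<not> Good (x # q)} = A - ?X" using Suc.prems by auto
      also have "real (card (A - ?X)) = real (card A) - real (card ?X)"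
        using fA by (subst card_Diff_subset) (auto simp: of_nat_diff card_mono)
      finally have "real (card ?X) \<le> real (card A) - \<delta>" by simp
      \<comment> \<open>Weakens the step's failure rate from \<open>\<delta> / card A\<close> to
        \<open>\<delta> / card V\<close>, so that it is the same in every step.\<close>
      also have "\<dots> \<le> real (card A) - \<delta> / real (card V) * real (card A)"
      proof -
        have "card A \<le> card V" using Suc.prems assms(1) by (metis card_mono sup_ge2)
        hence "\<delta> * real (card A) \<le> \<delta> * real (card V)" using assms(2) by (intro mult_left_mono) auto
        thus ?thesis using Vpos by (simp add: field_simps)
      qed
      finally show "real (card ?X) \<le> ?\<rho> * real (card A)" by (simp add: algebra_simps)
    qed (use rho in simp)
    also have "\<dots> = ?\<rho> ^ Suc m * (real (card A) * fact (card A - 1))" by simp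
    also have "real (card A) * fact (card A - 1) = fact (card A)"
      using neA fA by (simp add: fact_reduce[of "card A"] card_gt_0_iff)
    finally show ?thesis .
  qed
qed

context truncated_pivot begin

text \<open>Up to position \<open>k\<close> every surviving neighbour of no larger degree is alive,
  so placing it next makes it a pivot and kills \<open>v\<close>. More than \<open>\<delta>\<close>
  such neighbours at the end means more than \<open>\<delta>\<close> dangerous choices at every
  earlier step, since the set only shrinks.\<close>

lemma card_many_late_nbrs_le:
  assumes "v \<in> V" and k: "\<And>i. ok v i \<longleftrightarrow> i \<le> k" and "k \<le> card V" "0 \<le> \<delta>" "\<delta> \<le> real (card V)"
  shows "real (card {xs \<in> orders. v \<in> truncated xs \<and> \<delta> < real (card (late_nbrs xs v))}) \<le>
    (1 - \<delta> / real (card V)) ^ k * fact (card V)"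
proof -
  define N where "N q = {w. {v, w} \<in> E \<and> vdeg E w \<le> vdeg E v \<and> \<not> killed q w}" for q
  define Good where "Good q \<longleftrightarrow> \<not> killed q v \<and> \<delta> < real (card (N q))" for q
  have fN: "finite (N q)" for q
    by (rule finite_subset[OF _ finite_V]) (use edgeD in \<open>auto simp: N_def\<close>)
  have mono: "Good q" if "Good (p @ q)" for p q
  proof -
    have "N (p @ q) \<subseteq> N q" unfolding N_def using killed_append by blast
    hence "card (N (p @ q)) \<le> card (N q)" using fN card_mono by blast
    thus ?thesis using that killed_append unfolding Good_def by fastforce
  qed
  have step: "\<delta> \<le> real (card {x \<in> V - set q. \<not> Good (x # q)})" if q: "length q < k" "Good q" for q
  proof -
    have "N q \<subseteq> {x \<in> V - set q. \<not> Good (x # q)}"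
    proof
      fix x assume x: "x \<in> N q"
      hence e: "{v, x} \<in> E" and nk: "\<not> killed q x" unfolding N_def by auto
      have "ok v (Suc (length q))" using k q by simp
      hence okx: "ok x (Suc (length q))" using x ok_degree unfolding N_def by blast
      hence al: "alive q x" using nk unfolding alive_def by blast
      have "killed (x # q) v" unfolding killed_def using alive_piv_Cons[OF al] e edge_sym by blast
      thus "x \<in> {x \<in> V - set q. \<not> Good (x # q)}"
        using alive_notin[OF al] edgeD[OF e] unfolding Good_def by blast
    qed
    hence "card (N q) \<le> card {x \<in> V - set q. \<not> Good (x # q)}" by (intro card_mono) (use finite_V in auto)
    thus ?thesis using q(2) unfolding Good_def by linarith
  qed
  have "{xs \<in> orders. v \<in> truncated xs \<and> \<delta> < real (card (late_nbrs xs v))} \<subseteq>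
    {ys \<in> orders. \<forall>i\<le>k. Good (rev (take i ys) @ [])}"
  proof safe
    fix xs i assume xs: "xs \<in> orders" "v \<in> truncated xs" "\<delta> < real (card (late_nbrs xs v))" "i \<le> k"
    have pk: "piv (rev (take k xs)) = {u \<in> piv (rev xs). ok v (rank xs u)}"
      using piv_take[OF xs(1)] k by simp
    have "late_nbrs xs v = N (rev (take k xs))"
      unfolding late_nbrs_def N_def killed_def pk by blast
    moreover have "\<not> killed (rev (take k xs)) v"
      using xs(2) unfolding truncated_def killed_def pk by blast
    ultimately have "Good (rev (take k xs))" using xs(3) unfolding Good_def by simp
    moreover have "take k xs = take i xs @ take (k - i) (drop i xs)"
      using xs(4) by (metis le_add_diff_inverse take_add)
    ultimately show "Good (rev (take i xs) @ [])" using mono by (metis append_Nil2 rev_append)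
  qed
  hence "card {xs \<in> orders. v \<in> truncated xs \<and> \<delta> < real (card (late_nbrs xs v))} \<le>
    card {ys \<in> orders. \<forall>i\<le>k. Good (rev (take i ys) @ [])}"
    by (rule card_mono[rotated]) (use finite_V in auto)
  also have "real \<dots> \<le> (1 - \<delta> / real (card V)) ^ k * fact (card V)"
    by (rule card_prefix_survival_le[where k = k]) (use finite_V assms step in auto)
  finally show ?thesis by simp
qed

end

section \<open>Law of the stream and of the order\<close>

text \<open>The least \<open>j\<close> with \<open>d\<close> at most \<open>theta t j\<close>. It is
  also the number of class switches on the way from degree 0 to \<open>d\<close>, that is, the
  number of coins flipped.\<close>

definition class_index :: "nat \<Rightarrow> nat \<Rightarrow> nat" where
  "class_index t d = (LEAST j. d \<le> 2 ^ j * t)"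

lemma theta_eq: "theta t j = 2 ^ j * t"
  by (induction j) auto

lemma class_index_upper:
  assumes "t > 0"
  shows "d \<le> 2 ^ class_index t d * t"
proof -
  have "d \<le> 2 ^ d * 1" using less_exp[of d] by simp
  also have "\<dots> \<le> 2 ^ d * t" using assms by (intro mult_le_mono2) simp
  finally have "d \<le> 2 ^ d * t" .
  thus ?thesis unfolding class_index_def by (rule LeastI)
qed

lemma class_index_le: "d \<le> 2 ^ j * t \<Longrightarrow> class_index t d \<le> j"
  unfolding class_index_def by (rule Least_le)

lemma class_index_0 [simp]: "class_index t 0 = 0"
  using class_index_le[of 0 0 t] by simp

lemma mem_degree_class_iff:
  assumes "t > 0"
  shows "d \<in> degree_class t j \<longleftrightarrow> class_index t d = j"
proof (cases j)
  case 0
  show ?thesis using class_index_upper[OF assms, of d] class_index_le[of d 0 t] by (auto simp: 0)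
next
  case (Suc i)
  show ?thesis
  proof
    assume d: "d \<in> degree_class t j"
    hence "class_index t d \<le> Suc i" by (intro class_index_le) (simp add: Suc theta_eq)
    moreover have "\<not> class_index t d \<le> i"
    proof
      assume "class_index t d \<le> i"
      hence "2 ^ class_index t d * t \<le> 2 ^ i * t" by (intro mult_le_mono1 power_increasing) auto
      hence "d \<le> 2 ^ i * t" using class_index_upper[OF assms, of d] by (rule le_trans[rotated])
      thus False using d by (simp add: Suc theta_eq)
    qed
    ultimately show "class_index t d = j" using Suc by simp
  next
    assume j: "class_index t d = j"
    hence "\<not> d \<le> 2 ^ i * t" using class_index_le[of d i t] Suc by auto
    thus "d \<in> degree_class t j" using class_index_upper[OF assms, of d] j by (simp add: Suc theta_eq)
  qed
qed

text \<open>The thresholds double and are positive, so one more edge cannot jump over a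
  class.\<close>

lemma class_index_Suc:
  assumes "t > 0"
  shows "class_index t (Suc d) = class_index t d + (if switches_class t d (d + 1) then 1 else 0)"
proof -
  have "switches_class t d (d + 1) \<longleftrightarrow> class_index t d \<noteq> class_index t (Suc d)"
    unfolding switches_class_def by (auto simp: mem_degree_class_iff[OF assms])
  moreover have "class_index t d \<le> class_index t (Suc d)"
    using class_index_upper[OF assms, of "Suc d"] by (intro class_index_le) simp
  moreover have "class_index t (Suc d) \<le> Suc (class_index t d)"
  proof (rule class_index_le)
    have "1 \<le> 2 ^ class_index t d * t" using assms by simp
    hence "Suc d \<le> 2 ^ class_index t d * t + 2 ^ class_index t d * t"
      using class_index_upper[OF assms, of d] by linarith
    thus "Suc d \<le> 2 ^ Suc (class_index t d) * t" by simp
  qed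
  ultimately show ?thesis by auto
qed

lemma class_index_lower:
  assumes "t > 0" "class_index t d \<noteq> 0"
  shows "2 ^ class_index t d * t < 2 * d"
proof -
  obtain i where i: "class_index t d = Suc i" using assms by (cases "class_index t d") auto
  hence "\<not> d \<le> 2 ^ i * t" using class_index_le[of d i t] by auto
  thus ?thesis using i by simp
qed

text \<open>Given the bits, the rest of the state is a function of the revealed edge set
  \<open>F\<close>; the arrival order has no other influence. Interesting means that all coins so
  far came up 0.\<close>

definition state_inv :: "nat \<Rightarrow> 'v set set \<Rightarrow> 'v alg_state \<Rightarrow> bool" where
  "state_inv t F s \<longleftrightarrow> (\<forall>u. cur_deg s u = vdeg F u \<and> length (bits s u) = class_index t (vdeg F u) \<and>
     (interesting s u \<longleftrightarrow> True \<notin> set (bits s u)) \<and>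
     stored s u = (if interesting s u then {e \<in> F. u \<in> e} else {}))"

lemma state_inv_init: "state_inv t {} init_state"
  by (simp add: state_inv_def init_state_def vdeg_def)

lemma vdeg_insert:
  assumes "finite F" "e \<notin> F"
  shows "vdeg (insert e F) u = vdeg F u + (if u \<in> e then 1 else 0)"
proof -
  have "{e' \<in> insert e F. u \<in> e'} = (if u \<in> e then insert e {e' \<in> F. u \<in> e'} else {e' \<in> F. u \<in> e'})" by auto
  thus ?thesis using assms by (simp add: vdeg_def)
qed

lemma state_inv_process_edge:
  assumes "t > 0" "state_inv t F s" "finite F" "e \<notin> F" "s' \<in> set_pmf (process_edge t e s)"
  shows "state_inv t (insert e F) s'"
proof -
  define W where "W = {u \<in> e. switches_class t (cur_deg s u) (cur_deg s u + 1)}"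
  obtain b where s': "s' = update_state e W b s"
    using assms(5) unfolding process_edge_def Let_def W_def by auto
  show ?thesis unfolding state_inv_def
  proof (intro allI conjI)
    fix u
    note I = assms(2)[unfolded state_inv_def, rule_format, of u]
    note d = vdeg_insert[OF assms(3,4), of u]
    show "cur_deg s' u = vdeg (insert e F) u" using I d by (simp add: s' update_state_def)
    show "length (bits s' u) = class_index t (vdeg (insert e F) u)"
      using I d class_index_Suc[OF assms(1), of "vdeg F u"] by (auto simp: s' update_state_def W_def)
    show "interesting s' u \<longleftrightarrow> True \<notin> set (bits s' u)"
      using I by (auto simp: s' update_state_def)
    show "stored s' u = (if interesting s' u then {e' \<in> insert e F. u \<in> e'} else {})"
      using I by (auto simp: s' update_state_def)
  qed
qed

text \<open>The last conjunct covers every intermediate state, as required for bounding the peak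
  memory.\<close>

lemma stream_phase_inv:
  assumes "t > 0" "finite E" "adaptive_order E ne" "k \<le> card E" "h \<in> set_pmf (stream_phase t ne k)"
  shows "fst ` set h \<subseteq> E \<and> card (fst ` set h) = k \<and> state_inv t (fst ` set h) (cur_state h) \<and>
    (\<forall>(e, s)\<in>set h. \<exists>F\<subseteq>E. state_inv t F s)"
  using assms(4,5)
proof (induction k arbitrary: h)
  case 0
  thus ?case by (simp add: cur_state_def state_inv_init)
next
  case (Suc k)
  obtain h' s where h': "h' \<in> set_pmf (stream_phase t ne k)" "h = h' @ [(ne h', s)]"
    "s \<in> set_pmf (process_edge t (ne h') (cur_state h'))"
    using Suc.prems by auto
  note IH = Suc.IH[OF _ h'(1)]
  let ?F = "fst ` set h'"
  have F: "?F \<subseteq> E" "card ?F = k" "state_inv t ?F (cur_state h')" using IH Suc.prems by auto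
  hence "?F \<subset> E" using Suc.prems by auto
  hence ne: "ne h' \<in> E - ?F" using assms(3) unfolding adaptive_order_def by blast
  have inv: "state_inv t (insert (ne h') ?F) s"
    by (rule state_inv_process_edge[OF assms(1) F(3) _ _ h'(3)]) (use ne in auto)
  have "fst ` set h = insert (ne h') ?F" "cur_state h = s" using h'(2) by (auto simp: cur_state_def)
  moreover have "insert (ne h') ?F \<subseteq> E" using F ne by auto
  moreover have "card (insert (ne h') ?F) = Suc k" using F ne by (subst card_insert_disjoint) auto
  moreover have "\<forall>(e, s)\<in>set h'. \<exists>F\<subseteq>E. state_inv t F s" using IH Suc.prems by auto
  moreover have "\<forall>(e, s)\<in>set h. \<exists>F\<subseteq>E. state_inv t F s"
    unfolding h'(2) using calculation(3,5) inv by (auto simp del: insert_subset)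
  ultimately show ?case using inv by simp
qed

section \<open>Deferred decisions: bits flipped early or at completion\<close>

lemma Pi_pmf_extend:
  assumes "finite V" "W \<subseteq> V"
  shows "Pi_pmf W d (\<lambda>_. p) = Pi_pmf V d (\<lambda>u. if u \<in> W then p else return_pmf d)"
proof -
  have "{u \<in> V. u \<in> W} = W" using assms(2) by auto
  thus ?thesis using Pi_pmf_if_set[OF assms(1), of d "\<lambda>u. u \<in> W" "\<lambda>_. p"] by simp
qed

text \<open>Node by node, a coin flipped now followed by a shorter completion has the law of one
  longer completion. The length hypothesis leaves room for the new bit; with truncated subtraction a
  full string would otherwise grow beyond \<open>L\<close>.\<close>

lemma complete_strings_process_edge:
  assumes "finite V" "e \<subseteq> V"
    and len: "\<And>u. u \<in> e \<Longrightarrow> switches_class t (cur_deg s u) (cur_deg s u + 1) \<Longrightarrow> length (bits s u) < L"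
  shows "bind_pmf (process_edge t e s) (complete_strings V L) = complete_strings V L s"
proof -
  define W where "W = {u \<in> e. switches_class t (cur_deg s u) (cur_deg s u + 1)}"
  define p where "p = (\<lambda>u. if u \<in> W then fair_coin else return_pmf False)"
  define q where "q = (\<lambda>u b. let y = (if u \<in> W then bits s u @ [b] else bits s u) in
    map_pmf (\<lambda>x. y @ x) (replicate_pmf (L - length y) fair_coin))"
  have W: "W \<subseteq> V" using assms(2) by (auto simp: W_def)
  have pi: "Pi_pmf W False (\<lambda>_. fair_coin) = Pi_pmf V False p"
    unfolding p_def by (rule Pi_pmf_extend[OF assms(1) W])
  have "bind_pmf (process_edge t e s) (complete_strings V L) =
      bind_pmf (Pi_pmf V False p) (\<lambda>b. complete_strings V L (update_state e W b s))"
    unfolding process_edge_def Let_def W_def[symmetric] pi by (simp add: bind_map_pmf)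
  also have "\<dots> = bind_pmf (Pi_pmf V False p) (\<lambda>b. Pi_pmf V [] (\<lambda>u. q u (b u)))"
    by (intro bind_pmf_cong refl) (simp add: complete_strings_def update_state_def q_def Let_def)
  also have "\<dots> = Pi_pmf V [] (\<lambda>u. bind_pmf (p u) (q u))"
    by (rule Pi_pmf_bind[OF assms(1), symmetric])
  also have "\<dots> = complete_strings V L s"
    unfolding complete_strings_def
  proof (intro Pi_pmf_cong refl)
    fix u assume "u \<in> V"
    show "bind_pmf (p u) (q u) = map_pmf (\<lambda>x. bits s u @ x) (replicate_pmf (L - length (bits s u)) fair_coin)"
    proof (cases "u \<in> W")
      case False
      thus ?thesis by (simp add: p_def q_def bind_return_pmf Let_def)
    next
      case True
      hence "length (bits s u) < L" using len by (auto simp: W_def)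
      hence "L - length (bits s u) = Suc (L - Suc (length (bits s u)))" by simp
      thus ?thesis using True
        by (simp add: p_def q_def map_bind_pmf map_pmf_def bind_assoc_pmf bind_return_pmf Let_def)
    qed
  qed
  finally show ?thesis .
qed

abbreviation random_strings :: "'v set \<Rightarrow> nat \<Rightarrow> ('v \<Rightarrow> bool list) pmf" where
  "random_strings V L \<equiv> Pi_pmf V [] (\<lambda>_. replicate_pmf L fair_coin)"

lemma vdeg_less_card:
  assumes "simple_graph V E" "u \<in> V"
  shows "vdeg E u < card V"
proof -
  have f: "finite V" using assms by (simp add: simple_graph_def)
  have "{e \<in> E. u \<in> e} \<subseteq> (\<lambda>w. {u, w}) ` (V - {u})"
  proof
    fix e assume e: "e \<in> {e \<in> E. u \<in> e}"
    hence "card e = 2" "e \<subseteq> V" using assms(1) by (auto simp: simple_graph_def)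
    thus "e \<in> (\<lambda>w. {u, w}) ` (V - {u})" using e by (auto simp: card_2_iff)
  qed
  hence "vdeg E u \<le> card (V - {u})"
    unfolding vdeg_def using f by (meson card_image_le card_mono finite_Diff finite_imageI le_trans)
  also have "\<dots> < card V" using f assms(2) by (intro psubset_card_mono) auto
  finally show ?thesis .
qed

lemma simple_graph_mono: "simple_graph V E \<Longrightarrow> F \<subseteq> E \<Longrightarrow> simple_graph V F"
  by (auto simp: simple_graph_def)

text \<open>For a nonzero class, \<open>2 ^ j * t < 2 * d\<close> and \<open>t \<ge> 2\<close> give
  \<open>2 ^ j < d\<close>. So a node flips at most \<open>log 2 n\<close> coins and its string
  never overflows.\<close>

lemma class_index_length:
  assumes "t \<ge> 2" "d < n" "real n \<le> 2 ^ L"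
  shows "class_index t d \<le> L" "2 ^ class_index t d \<le> n"
proof -
  have *: "2 ^ class_index t d \<le> n"
  proof (cases "class_index t d = 0")
    case False
    have "2 ^ class_index t d * 2 \<le> 2 ^ class_index t d * t" using assms(1) by simp
    also have "\<dots> < 2 * d" using class_index_lower[OF _ False] assms(1) by simp
    finally show ?thesis using assms(2) by simp
  qed (use assms in simp)
  thus "2 ^ class_index t d \<le> n" .
  hence "2 ^ class_index t d \<le> (2 :: real) ^ L"
    using assms(3) by (metis of_nat_le_iff of_nat_numeral of_nat_power order_trans)
  thus "class_index t d \<le> L" by simp
qed

lemma complete_strings_stream_phase:
  assumes "simple_graph V E" "adaptive_order E ne" "t \<ge> 2" "real (card V) \<le> 2 ^ L" "k \<le> card E"
  shows "bind_pmf (stream_phase t ne k) (\<lambda>h. complete_strings V L (cur_state h)) = random_strings V L"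
  using assms(5)
proof (induction k)
  case 0
  show ?case by (simp add: bind_return_pmf cur_state_def init_state_def complete_strings_def map_pmf_def bind_return_pmf')
next
  case (Suc k)
  have fE: "finite E" using simple_graph_finite_edges assms(1) .
  have fV: "finite V" using assms(1) by (simp add: simple_graph_def)
  have "bind_pmf (stream_phase t ne (Suc k)) (\<lambda>h. complete_strings V L (cur_state h)) =
      bind_pmf (stream_phase t ne k) (\<lambda>h. bind_pmf (process_edge t (ne h) (cur_state h)) (complete_strings V L))"
    by (simp add: bind_assoc_pmf bind_map_pmf cur_state_def)
  also have "\<dots> = bind_pmf (stream_phase t ne k) (\<lambda>h. complete_strings V L (cur_state h))"
  proof (intro bind_pmf_cong refl)
    fix h assume h: "h \<in> set_pmf (stream_phase t ne k)"
    have inv: "fst ` set h \<subseteq> E" "card (fst ` set h) = k" "state_inv t (fst ` set h) (cur_state h)"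
      using stream_phase_inv[OF _ fE assms(2) _ h] assms(3) Suc.prems by auto
    let ?F = "fst ` set h"
    have "?F \<subset> E" using inv Suc.prems by auto
    hence ne: "ne h \<in> E - ?F" using assms(2) unfolding adaptive_order_def by blast
    show "bind_pmf (process_edge t (ne h) (cur_state h)) (complete_strings V L) = complete_strings V L (cur_state h)"
    proof (rule complete_strings_process_edge[OF fV])
      show eV: "ne h \<subseteq> V" using ne assms(1) by (auto simp: simple_graph_def)
      fix u assume u: "u \<in> ne h" "switches_class t (cur_deg (cur_state h) u) (cur_deg (cur_state h) u + 1)"
      have deg: "cur_deg (cur_state h) u = vdeg ?F u" "length (bits (cur_state h) u) = class_index t (vdeg ?F u)"
        using inv(3) by (auto simp: state_inv_def)
      have "vdeg (insert (ne h) ?F) u = Suc (vdeg ?F u)" using ne u by (subst vdeg_insert) auto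
      moreover have "vdeg (insert (ne h) ?F) u < card V"
        by (rule vdeg_less_card[OF simple_graph_mono[OF assms(1)]]) (use ne inv u eV in auto)
      ultimately have "class_index t (Suc (vdeg ?F u)) \<le> L"
        using class_index_length(1)[OF assms(3) _ assms(4)] by simp
      thus "length (bits (cur_state h) u) < L"
        using deg u(2) class_index_Suc[of t "vdeg ?F u"] assms(3) by simp
    qed
  qed
  finally show ?case using Suc by simp
qed

text \<open>The first \<open>class_index\<close> bits of a completed string are exactly the coins
  flipped in the stream, so they reveal whether the node is interesting without reference to the
  history.\<close>

definition final_state :: "nat \<Rightarrow> 'v set set \<Rightarrow> ('v \<Rightarrow> bool list) \<Rightarrow> 'v alg_state" where
  "final_state t E r =
     \<lparr>cur_deg = vdeg E, bits = r, interesting = (\<lambda>u. True \<notin> set (take (class_index t (vdeg E u)) (r u))),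
      stored = (\<lambda>u. if True \<notin> set (take (class_index t (vdeg E u)) (r u)) then {e \<in> E. u \<in> e} else {})\<rparr>"

lemma final_state_eq:
  assumes "simple_graph V E" "state_inv t E s" "r \<in> set_pmf (complete_strings V L s)"
  shows "s\<lparr>bits := r\<rparr> = final_state t E r"
proof -
  have fV: "finite V" using assms(1) by (simp add: simple_graph_def)
  have "take (class_index t (vdeg E u)) (r u) = bits s u" for u
  proof (cases "u \<in> V")
    case True
    obtain x where "r u = bits s u @ x"
      using assms(3) True set_Pi_pmf_subset'[OF fV] unfolding complete_strings_def PiE_dflt_def
      by fastforce
    thus ?thesis using assms(2) by (simp add: state_inv_def)
  next
    \<comment> \<open>Outside \<open>V\<close> no completion takes place, but the degree there is 0,
      so both sides are empty.\<close>
    case False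
    hence "{e \<in> E. u \<in> e} = {}" using assms(1) by (auto simp: simple_graph_def)
    hence "vdeg E u = 0" unfolding vdeg_def by (simp only: card.empty)
    moreover have "length (bits s u) = class_index t (vdeg E u)"
      using assms(2) unfolding state_inv_def by blast
    ultimately show ?thesis by simp
  qed
  moreover have "cur_deg s = vdeg E" "interesting s = (\<lambda>u. True \<notin> set (bits s u))"
    "stored s = (\<lambda>u. if True \<notin> set (bits s u) then {e \<in> E. u \<in> e} else {})"
    using assms(2) by (auto simp: state_inv_def fun_eq_iff)
  ultimately show ?thesis by (cases s) (simp add: final_state_def)
qed

lemma output_clustering_bits: "output_clustering V \<epsilon> c (s\<lparr>bits := r\<rparr>) xs = output_clustering V \<epsilon> c s xs"
  by (simp add: output_clustering_def cluster_label_def pivots_def final_interesting_def store_graph_def Let_def)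

text \<open>Once the final state is expressed by the strings, the history enters only through their
  law and is integrated out.\<close>

lemma map_fst_streaming_truncated_pivot:
  assumes "simple_graph V E" "adaptive_order E ne" "theta0 (card V) \<epsilon> c \<ge> 2"
    "real (card V) \<le> 2 ^ string_length (card V) a"
  shows "map_pmf fst (streaming_truncated_pivot \<epsilon> c a V E ne) =
    bind_pmf (random_strings V (string_length (card V) a)) (\<lambda>r.
      map_pmf (output_clustering V \<epsilon> c (final_state (theta0 (card V) \<epsilon> c) E r))
        (pmf_of_set (compatible_orders V r)))"
proof -
  let ?t = "theta0 (card V) \<epsilon> c" and ?L = "string_length (card V) a"
  have fE: "finite E" using simple_graph_finite_edges assms(1) .
  have "map_pmf fst (streaming_truncated_pivot \<epsilon> c a V E ne) =
    bind_pmf (stream_phase ?t ne (card E)) (\<lambda>h. bind_pmf (complete_strings V ?L (cur_state h))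
      (\<lambda>r. map_pmf (output_clustering V \<epsilon> c (cur_state h)) (pmf_of_set (compatible_orders V r))))"
    by (simp add: streaming_truncated_pivot_def map_bind_pmf map_pmf_def bind_assoc_pmf bind_return_pmf)
  also have "\<dots> = bind_pmf (stream_phase ?t ne (card E)) (\<lambda>h. bind_pmf (complete_strings V ?L (cur_state h))
      (\<lambda>r. map_pmf (output_clustering V \<epsilon> c (final_state ?t E r)) (pmf_of_set (compatible_orders V r))))"
  proof (intro bind_pmf_cong refl)
    fix h r assume h: "h \<in> set_pmf (stream_phase ?t ne (card E))"
      and r: "r \<in> set_pmf (complete_strings V ?L (cur_state h))"
    have "fst ` set h \<subseteq> E" "card (fst ` set h) = card E" "state_inv ?t (fst ` set h) (cur_state h)"
      using stream_phase_inv[OF _ fE assms(2) _ h] assms(3) by auto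
    hence "state_inv ?t E (cur_state h)" using card_subset_eq[OF fE] by metis
    hence eq: "(cur_state h)\<lparr>bits := r\<rparr> = final_state ?t E r" by (rule final_state_eq[OF assms(1) _ r])
    have "output_clustering V \<epsilon> c (cur_state h) = output_clustering V \<epsilon> c (final_state ?t E r)"
      unfolding eq[symmetric] by (rule ext) (simp only: output_clustering_bits)
    thus "map_pmf (output_clustering V \<epsilon> c (cur_state h)) (pmf_of_set (compatible_orders V r)) =
      map_pmf (output_clustering V \<epsilon> c (final_state ?t E r)) (pmf_of_set (compatible_orders V r))"
      by simp
  qed
  also have "\<dots> = bind_pmf (bind_pmf (stream_phase ?t ne (card E)) (\<lambda>h. complete_strings V ?L (cur_state h)))
      (\<lambda>r. map_pmf (output_clustering V \<epsilon> c (final_state ?t E r)) (pmf_of_set (compatible_orders V r)))"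
    by (simp add: bind_assoc_pmf)
  finally show ?thesis using complete_strings_stream_phase[OF assms(1-4)] by simp
qed

section \<open>Uniformity of the order\<close>

lemma sorted_permutation_exists:
  assumes "finite A" "\<And>x y. R x y \<or> R y x" "\<And>x y z. R x y \<Longrightarrow> R y z \<Longrightarrow> R x z"
  shows "\<exists>xs\<in>permutations_of_set A. sorted_wrt R xs"
  using assms(1)
proof (induction A)
  case (insert x A)
  then obtain xs where xs: "xs \<in> permutations_of_set A" "sorted_wrt R xs" by blast
  let ?ys = "filter (\<lambda>y. R y x) xs @ x # filter (\<lambda>y. \<not> R y x) xs"
  have "?ys \<in> permutations_of_set (insert x A)"
    using xs insert.hyps by (auto simp: permutations_of_set_def)
  moreover have "sorted_wrt R ?ys"
    using xs(2) assms(2,3) unfolding sorted_wrt_append by (auto simp: sorted_wrt_filter) metis+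
  ultimately show ?case by blast
qed simp

lemma compatible_orders_nonempty: "finite V \<Longrightarrow> compatible_orders V r \<noteq> {}"
  using sorted_permutation_exists[of V "\<lambda>u v. lexordp_eq (r u) (r v)"] lexordp_eq_linear lexordp_eq_trans
  unfolding compatible_orders_def by blast

lemma finite_compatible_orders: "finite (compatible_orders V r)"
  unfolding compatible_orders_def by simp

lemma compatible_orders_permute:
  assumes "\<sigma> permutes V"
  shows "map \<sigma> ` compatible_orders V r = compatible_orders V (r \<circ> inv \<sigma>)"
proof -
  have inv: "inv \<sigma> (\<sigma> x) = x" "\<sigma> (inv \<sigma> x) = x" for x using permutes_inverses[OF assms] by auto
  have sw: "sorted_wrt (\<lambda>u v. lexordp_eq ((r \<circ> inv \<sigma>) u) ((r \<circ> inv \<sigma>) v)) (map \<sigma> xs) \<longleftrightarrow>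
    sorted_wrt (\<lambda>u v. lexordp_eq (r u) (r v)) xs" for xs
    by (simp add: sorted_wrt_map inv)
  note im = permutations_of_set_image_permutes[OF assms]
  show ?thesis
  proof (intro subset_antisym subsetI)
    fix ys assume "ys \<in> map \<sigma> ` compatible_orders V r"
    then obtain xs where xs: "xs \<in> compatible_orders V r" "ys = map \<sigma> xs" by blast
    hence "ys \<in> permutations_of_set V" using im unfolding compatible_orders_def by blast
    thus "ys \<in> compatible_orders V (r \<circ> inv \<sigma>)" using xs sw unfolding compatible_orders_def by simp
  next
    fix ys assume ys: "ys \<in> compatible_orders V (r \<circ> inv \<sigma>)"
    then obtain xs where xs: "xs \<in> permutations_of_set V" "ys = map \<sigma> xs"
      using im unfolding compatible_orders_def by blast
    hence "xs \<in> compatible_orders V r" using ys sw unfolding compatible_orders_def by simp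
    thus "ys \<in> map \<sigma> ` compatible_orders V r" using xs by blast
  qed
qed

lemma ex_permutes_map:
  assumes "xs \<in> permutations_of_set V" "ys \<in> permutations_of_set V"
  shows "\<exists>\<sigma>. \<sigma> permutes V \<and> map \<sigma> xs = ys"
proof -
  have x: "distinct xs" "set xs = V" and y: "distinct ys" "set ys = V"
    using assms by (auto simp: permutations_of_set_def)
  have len: "length xs = length ys" using x y distinct_card by metis
  define f where "f = (\<lambda>v. ys ! (inv_into {..<length xs} ((!) xs) v))"
  have bx: "bij_betw ((!) xs) {..<length xs} V" using bij_betw_nth[OF x(1)] x(2) by simp
  have bY: "bij_betw ((!) ys) {..<length xs} V" using bij_betw_nth[OF y(1)] y(2) len by simp
  have "bij_betw f V V"
    using bij_betw_trans[OF bij_betw_inv_into[OF bx] bY] by (simp add: f_def comp_def)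
  define \<sigma> where "\<sigma> = (\<lambda>v. if v \<in> V then f v else v)"
  have "bij_betw \<sigma> V V" using \<open>bij_betw f V V\<close> by (rule bij_betw_cong[THEN iffD1, rotated]) (simp add: \<sigma>_def)
  hence "\<sigma> permutes V" by (rule bij_imp_permutes) (simp add: \<sigma>_def)
  moreover have "map \<sigma> xs = ys"
  proof (rule nth_equalityI)
    fix i assume "i < length (map \<sigma> xs)"
    hence i: "i < length xs" by simp
    hence "inv_into {..<length xs} ((!) xs) (xs ! i) = i"
      using bx by (intro inv_into_f_f) (auto simp: bij_betw_def)
    thus "map \<sigma> xs ! i = ys ! i" using i x by (auto simp: \<sigma>_def f_def)
  qed (simp add: len)
  ultimately show ?thesis by blast
qed

lemma pmf_of_setI:
  assumes "finite A" "set_pmf p \<subseteq> A" "\<And>x y. x \<in> A \<Longrightarrow> y \<in> A \<Longrightarrow> pmf p x = pmf p y"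
  shows "p = pmf_of_set A"
proof (rule pmf_eqI)
  fix x
  have ne: "A \<noteq> {}" using assms(2) set_pmf_not_empty[of p] by blast
  show "pmf p x = pmf (pmf_of_set A) x"
  proof (cases "x \<in> A")
    case False
    thus ?thesis using assms ne by (auto simp: pmf_eq_0_set_pmf)
  next
    case True
    have "1 = (\<Sum>y\<in>A. pmf p y)" using sum_pmf_eq_1[OF assms(1,2)] by simp
    also have "\<dots> = (\<Sum>y\<in>A. pmf p x)" by (intro sum.cong refl assms(3)) (use True in auto)
    finally have "real (card A) * pmf p x = 1" by simp
    thus ?thesis using True ne assms(1) by (simp add: field_simps)
  qed
qed

text \<open>Relabelling the nodes preserves the law of independent identically distributed strings
  and maps compatible orders to compatible orders. The law of the order is thus invariant under all
  permutations of \<open>V\<close>, which act transitively on the orders. Uniform tie-breaking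
  respects this symmetry.\<close>

lemma random_order_uniform:
  assumes "finite V"
  shows "bind_pmf (random_strings V L) (\<lambda>r. pmf_of_set (compatible_orders V r)) =
    pmf_of_set (permutations_of_set V)"
proof (rule pmf_of_setI)
  let ?U = "random_strings V L"
  let ?D = "bind_pmf ?U (\<lambda>r. pmf_of_set (compatible_orders V r))"
  show "finite (permutations_of_set V)" by simp
  show "set_pmf ?D \<subseteq> permutations_of_set V"
    using compatible_orders_nonempty[OF assms] finite_compatible_orders
    by (auto simp: compatible_orders_def[symmetric]) (auto simp: compatible_orders_def)
  fix xs ys assume "xs \<in> permutations_of_set V" "ys \<in> permutations_of_set V"
  then obtain \<sigma> where \<sigma>: "\<sigma> permutes V" "map \<sigma> xs = ys" using ex_permutes_map by blast
  have inj: "inj (map \<sigma>)" using permutes_inj[OF \<sigma>(1)] by simp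
  have "bij_betw (inv \<sigma>) V V" by (rule permutes_imp_bij[OF permutes_inv[OF \<sigma>(1)]])
  hence U: "?U = map_pmf (\<lambda>r. r \<circ> inv \<sigma>) ?U"
    by (intro Pi_pmf_bij_betw[OF assms]) (use permutes_not_in[OF permutes_inv[OF \<sigma>(1)]] in auto)
  have "map_pmf (map \<sigma>) ?D = bind_pmf ?U (\<lambda>r. map_pmf (map \<sigma>) (pmf_of_set (compatible_orders V r)))"
    by (simp add: map_bind_pmf)
  also have "\<dots> = bind_pmf ?U (\<lambda>r. pmf_of_set (map \<sigma> ` compatible_orders V r))"
    by (intro bind_pmf_cong refl map_pmf_of_set_inj compatible_orders_nonempty[OF assms] finite_compatible_orders
        inj_on_subset[OF inj]) simp
  also have "\<dots> = bind_pmf (map_pmf (\<lambda>r. r \<circ> inv \<sigma>) ?U) (\<lambda>r. pmf_of_set (compatible_orders V r))"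
    by (simp add: bind_map_pmf compatible_orders_permute[OF \<sigma>(1)])
  also have "\<dots> = ?D" by (subst U[symmetric]) simp
  finally have "pmf ?D ys = pmf (map_pmf (map \<sigma>) ?D) (map \<sigma> xs)" using \<sigma>(2) by simp
  also have "\<dots> = pmf ?D xs" by (rule pmf_map_inj'[OF inj])
  finally show "pmf ?D xs = pmf ?D ys" by simp
qed

section \<open>Expected cost\<close>

lemma greedy_mis_append: "greedy_mis F M (xs @ ys) = greedy_mis F (greedy_mis F M xs) ys"
  by (induction xs arbitrary: M) auto

lemma greedy_mis_subset: "greedy_mis F M xs \<subseteq> M \<union> set xs"
proof (induction xs arbitrary: M)
  case (Cons x xs)
  show ?case using Cons[of M] Cons[of "insert x M"] by auto
qed simp

text \<open>Since \<open>False < True\<close>, a string with \<open>j\<close> leading zeros is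
  preceded only by such strings.\<close>

lemma lexordp_eq_leading_zeros:
  "lexordp_eq x y \<Longrightarrow> True \<notin> set (take j y) \<Longrightarrow> True \<notin> set (take j x)"
proof (induction x y arbitrary: j rule: lexordp_eq.induct)
  case (Cons x y xs ys)
  thus ?case by (cases j) auto
next
  case (Cons_eq x y xs ys)
  thus ?case by (cases j) auto
qed simp

text \<open>All nodes are tested against the same \<open>j\<close>, whatever their class, so that
  the size is a sum of independent trials. Membership matters for nodes whose class is
  \<open>j\<close>: these are the interesting ones.\<close>

definition leading_zeros :: "'v set \<Rightarrow> nat \<Rightarrow> ('v \<Rightarrow> bool list) \<Rightarrow> 'v set" where
  "leading_zeros V j r = {u \<in> V. True \<notin> set (take j (r u))}"

text \<open>The nodes with \<open>j\<close> leading zeros form an initial segment of every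
  compatible order.\<close>

lemma rank_le_leading_zeros:
  assumes "finite V" "xs \<in> compatible_orders V r" "v \<in> V" "rank xs v \<le> card (leading_zeros V j r)"
  shows "v \<in> leading_zeros V j r"
proof (rule ccontr)
  assume v: "v \<notin> leading_zeros V j r"
  have xs: "distinct xs" "set xs = V" "sorted_wrt (\<lambda>u v. lexordp_eq (r u) (r v)) xs"
    using assms(2) by (auto simp: compatible_orders_def permutations_of_set_def)
  obtain p q where pq: "xs = p @ v # q" using xs(2) assms(3) by (meson split_list)
  have vp: "v \<notin> set p" using pq xs(1) by auto
  have "leading_zeros V j r \<subseteq> set p"
  proof
    fix u assume u: "u \<in> leading_zeros V j r"
    hence "u \<in> V" "u \<noteq> v" using v by (auto simp: leading_zeros_def)
    moreover have "u \<notin> set q"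
    proof
      assume "u \<in> set q"
      hence "lexordp_eq (r v) (r u)" using xs(3) pq by (simp add: sorted_wrt_append)
      hence "v \<in> leading_zeros V j r"
        using lexordp_eq_leading_zeros u assms(3) unfolding leading_zeros_def by blast
      thus False using v by blast
    qed
    ultimately show "u \<in> set p" using xs(2) pq by auto
  qed
  hence "card (leading_zeros V j r) \<le> card (set p)" by (intro card_mono) auto
  also have "\<dots> \<le> length p" by (rule card_length)
  finally show False using assms(4) rank_append_Cons[OF vp, of q] pq by simp
qed

lemma map_replicate_leading_zeros:
  "j \<le> L \<Longrightarrow> map_pmf (\<lambda>x. True \<notin> set (take j x)) (replicate_pmf L fair_coin) = bernoulli_pmf ((1/2) ^ j)"
proof (induction j arbitrary: L)
  case 0
  show ?case by (rule pmf_eqI) (simp add: map_pmf_const pmf_return, metis (full_types) pmf_bernoulli_True pmf_bernoulli_False diff_self indicator_simps order_refl zero_le_one singleton_iff)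
next
  case (Suc j)
  then obtain L' where L: "L = Suc L'" "j \<le> L'" by (cases L) auto
  have "map_pmf (\<lambda>x. True \<notin> set (take (Suc j) x)) (replicate_pmf L fair_coin) =
    bind_pmf fair_coin (\<lambda>b. map_pmf (\<lambda>z. \<not> b \<and> z) (map_pmf (\<lambda>x. True \<notin> set (take j x)) (replicate_pmf L' fair_coin)))"
    by (simp add: L map_pmf_def bind_assoc_pmf bind_return_pmf)
  also have "\<dots> = bind_pmf fair_coin (\<lambda>b. map_pmf (\<lambda>z. \<not> b \<and> z) (bernoulli_pmf ((1/2) ^ j)))"
    using Suc.IH[OF L(2)] by simp
  also have "\<dots> = bernoulli_pmf ((1/2) ^ Suc j)"
  proof (rule pmf_eqI)
    fix z :: bool
    have p: "(1/2 :: real) ^ j \<le> 1" "(1/2 :: real) ^ Suc j \<le> 1" by (intro power_le_one; simp)+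
    have "pmf (map_pmf (\<lambda>z. False) (bernoulli_pmf ((1/2) ^ j))) z = (if z then 0 else 1)"
      by (simp add: map_pmf_const pmf_return indicator_def)
    moreover have "(\<and>) False = (\<lambda>_. False)" "(\<and>) True = (\<lambda>z. z)" by auto
    ultimately show "pmf (bind_pmf fair_coin (\<lambda>b. map_pmf (\<lambda>z. \<not> b \<and> z) (bernoulli_pmf ((1/2) ^ j)))) z =
      pmf (bernoulli_pmf ((1/2) ^ Suc j)) z"
      using p by (cases z) (simp_all add: pmf_bind map_pmf_ident diff_divide_distrib)
  qed
  finally show ?case .
qed

lemma finite_set_replicate_fair_coin: "finite (set_pmf (replicate_pmf L fair_coin))"
  using finite_lists_length_eq[of "UNIV :: bool set" L] by (simp add: set_replicate_pmf)

lemma finite_set_random_strings: "finite V \<Longrightarrow> finite (set_pmf (random_strings V L))"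
  by (rule finite_subset[OF set_Pi_pmf_subset'])
     (auto intro!: finite_PiE_dflt finite_set_replicate_fair_coin simp del: replicate_pmf.simps)

text \<open>Chernoff bound with base \<open>1/2\<close>: for a count \<open>X\<close> of mean
  \<open>2 * m\<close>, Markov's inequality gives at most \<open>2 powr m\<close> times the
  expectation of \<open>(1/2) ^ X\<close>, which is at most \<open>exp (- m)\<close>. With
  \<open>ln 2 \<le> 25/36\<close> the exponent is \<open>- (11/36) * m\<close>.\<close>

lemma leading_zeros_lower_tail:
  assumes "finite V" "j \<le> L"
  shows "measure_pmf.prob (random_strings V L) {r. real (card (leading_zeros V j r)) < real (card V) / 2 ^ j / 2}
    \<le> exp (- (11 / 72) * (real (card V) / 2 ^ j))"
proof -
  let ?U = "random_strings V L"
  define m where "m = real (card V) / 2 ^ j / 2"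
  define f where "f = (\<lambda>(_::'a) x. if True \<notin> set (take j x) then 1 / 2 else (1::real))"
  have int: "integrable (measure_pmf ?U) g" for g :: "_ \<Rightarrow> real"
    by (rule integrable_measure_pmf_finite) (rule finite_set_random_strings[OF assms(1)])
  have prod: "(\<Prod>u\<in>V. f u (r u)) = (1 / 2) ^ card (leading_zeros V j r)" for r
  proof -
    have "(\<Prod>u\<in>V. f u (r u)) = (\<Prod>u\<in>leading_zeros V j r. 1 / 2)"
      unfolding f_def leading_zeros_def using assms(1)
      by (simp add: prod.If_cases Collect_conj_eq)
    thus ?thesis by simp
  qed
  have single: "measure_pmf.expectation (replicate_pmf L fair_coin) (f u) = 1 - (1 / 2) ^ j / 2" for u
  proof -
    have "measure_pmf.expectation (replicate_pmf L fair_coin) (f u) =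
      measure_pmf.expectation (map_pmf (\<lambda>x. True \<notin> set (take j x)) (replicate_pmf L fair_coin))
        (\<lambda>b. if b then 1 / 2 else 1)"
      by (simp add: f_def)
    also have "\<dots> = 1 - (1 / 2) ^ j / 2"
      unfolding map_replicate_leading_zeros[OF assms(2)]
      by (subst integral_bernoulli_pmf) (auto simp: power_le_one field_simps)
    finally show ?thesis .
  qed
  have "measure_pmf.prob ?U {r. real (card (leading_zeros V j r)) < m} =
    measure_pmf.expectation ?U (indicator {r. real (card (leading_zeros V j r)) < m})"
    by simp
  also have "\<dots> \<le> measure_pmf.expectation ?U (\<lambda>r. 2 powr m * (\<Prod>u\<in>V. f u (r u)))"
  proof (rule integral_mono[OF int int])
    fix r
    show "indicator {r. real (card (leading_zeros V j r)) < m} r \<le> 2 powr m * (\<Prod>u\<in>V. f u (r u))"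
    proof (cases "real (card (leading_zeros V j r)) < m")
      case True
      have "(1::real) \<le> 2 powr (m - real (card (leading_zeros V j r)))"
        using True by (intro ge_one_powr_ge_zero) auto
      also have "\<dots> = 2 powr m * (\<Prod>u\<in>V. f u (r u))"
        unfolding prod by (simp add: powr_diff powr_realpow power_one_over divide_simps)
      finally show ?thesis using True by simp
    qed (simp add: prod)
  qed
  also have "\<dots> = 2 powr m * (\<Prod>u\<in>V. measure_pmf.expectation (replicate_pmf L fair_coin) (f u))"
    by (subst expectation_prod_Pi_pmf[symmetric])
       (auto intro!: assms integrable_measure_pmf_finite finite_set_replicate_fair_coin simp: f_def)
  also have "\<dots> = 2 powr m * (1 - (1 / 2) ^ j / 2) ^ card V" by (simp add: single)
  also have "\<dots> \<le> exp (25 / 36 * m) * exp (- m)"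
  proof (rule mult_mono)
    have m0: "0 \<le> m" by (simp add: m_def)
    have "m * ln 2 \<le> m * (25 / 36)" by (intro mult_left_mono ln2_le_25_over_36 m0)
    thus "2 powr m \<le> exp (25 / 36 * m)" by (simp add: powr_def mult.commute)
    have "(1 - (1 / 2 :: real) ^ j / 2) ^ card V \<le> exp (- ((1 / 2) ^ j / 2)) ^ card V"
    proof (rule power_mono)
      show "1 - (1 / 2) ^ j / 2 \<le> exp (- ((1 / 2 :: real) ^ j / 2))"
        using exp_ge_add_one_self[of "- ((1 / 2 :: real) ^ j / 2)"] by simp
      have "(1 / 2 :: real) ^ j \<le> 1" by (rule power_le_one) auto
      thus "0 \<le> 1 - (1 / 2 :: real) ^ j / 2" by simp
    qed
    also have "\<dots> = exp (- m)"
      by (simp add: exp_of_nat_mult[symmetric] m_def power_one_over)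
    finally show "(1 - (1 / 2) ^ j / 2) ^ card V \<le> exp (- m)" .
    have "(1 / 2 :: real) ^ j \<le> 1" by (rule power_le_one) auto
    thus "0 \<le> (1 - (1 / 2 :: real) ^ j / 2) ^ card V" by simp
  qed simp
  also have "\<dots> = exp (- (11 / 72) * (real (card V) / 2 ^ j))"
    by (simp add: exp_add[symmetric] m_def)
  finally show ?thesis unfolding m_def .
qed

lemma below_tau_antimono: "below_tau n \<epsilon> c d i \<Longrightarrow> j \<le> i \<Longrightarrow> below_tau n \<epsilon> c d j"
  unfolding below_tau_def by (meson of_nat_le_iff order_le_less_trans)

lemma below_tau_degree:
  assumes "\<epsilon> > 0" "c > 0" "d' \<le> d" "below_tau n \<epsilon> c d i"
  shows "below_tau n \<epsilon> c d' i"
proof (cases "d' = 0")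
  case False
  hence i: "real i < c / \<epsilon> * (real n * log 2 (real n) / real d)" and d: "0 < d'" "0 < d"
    using assms by (auto simp: below_tau_def)
  have "0 \<le> log 2 (real n)" by (cases "n = 0") (auto simp: log_def)
  hence "c / \<epsilon> * (real n * log 2 (real n) / real d) \<le> c / \<epsilon> * (real n * log 2 (real n) / real d')"
    using assms d by (intro mult_left_mono divide_left_mono mult_nonneg_nonneg) auto
  thus ?thesis using i by (simp add: below_tau_def)
qed (simp add: below_tau_def)

section \<open>The actual thresholds and the failure events\<close>

locale pivot_params =
  fixes V :: "'v set" and E :: "'v set set" and \<epsilon> c :: real
  assumes graph: "simple_graph V E" and \<epsilon>: "0 < \<epsilon>" "\<epsilon> < 1 / 4" and c: "c \<ge> 1" and n2: "card V \<ge> 2"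
begin

abbreviation "n \<equiv> card V"
abbreviation "t \<equiv> theta0 n \<epsilon> c"
abbreviation "ok \<equiv> \<lambda>v. below_tau n \<epsilon> c (vdeg E v)"

sublocale truncated_pivot V E ok
  by unfold_locales (use graph \<epsilon> c below_tau_antimono below_tau_degree in auto)

lemma log_n: "log 2 (real n) \<ge> 1"
  using n2 by (subst le_log_iff) auto

lemma t_lower: "4 * c / \<epsilon> * log 2 (real n) \<le> real t"
  unfolding theta0_def by linarith

lemma inv_\<epsilon>: "1 / \<epsilon> > 4"
  using \<epsilon> by (simp add: field_simps)

lemma t_lower_inverse: "4 / \<epsilon> \<le> real t"
proof -
  have "4 * 1 / \<epsilon> * 1 \<le> 4 * c / \<epsilon> * log 2 (real n)"
    using \<epsilon> c log_n by (intro mult_mono divide_right_mono) auto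
  thus ?thesis using t_lower by simp
qed

lemma t_ge_2: "t \<ge> 2"
  using t_lower_inverse inv_\<epsilon> by simp

text \<open>At degree 0 the division yields 0 although the threshold is infinite there;
  \<open>ok_iff\<close> therefore asks for positive degree.\<close>

definition tau :: "'v \<Rightarrow> real" where
  "tau v = c / \<epsilon> * (real n * log 2 (real n) / real (vdeg E v))"

lemma ok_iff: "vdeg E v > 0 \<Longrightarrow> ok v i \<longleftrightarrow> real i < tau v"
  by (simp add: below_tau_def tau_def)

text \<open>In class \<open>j > 0\<close> the degree exceeds \<open>2 ^ j * t / 2\<close>, hence is
  at least \<open>2 ^ j * (2 * c / \<epsilon>) * log 2 n\<close> by the factor 4 in
  \<open>theta0\<close>. The right-hand side is half the mean number of strings with
  \<open>j\<close> leading zeros, the level of the tail bound.\<close>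

lemma tau_le_class:
  assumes "class_index t (vdeg E v) = j" "j \<noteq> 0"
  shows "tau v \<le> real n / 2 ^ j / 2"
proof -
  have "2 ^ j * t < 2 * vdeg E v" using class_index_lower[of t "vdeg E v"] assms t_ge_2 by simp
  hence "real (2 ^ j * t) < real (2 * vdeg E v)" by (simp only: of_nat_less_iff)
  hence d: "2 ^ j * real t \<le> 2 * real (vdeg E v)" by simp
  have dpos: "0 < real (vdeg E v)" using \<open>2 ^ j * t < 2 * vdeg E v\<close> by simp
  define X where "X = 2 ^ j * (c / \<epsilon> * log 2 (real n))"
  have "4 * X = 2 ^ j * (4 * c / \<epsilon> * log 2 (real n))" by (simp add: X_def)
  also have "\<dots> \<le> 2 ^ j * real t" by (intro mult_left_mono t_lower) simp
  also note d
  finally have "2 * X \<le> real (vdeg E v)" by simp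
  hence "real n * (2 * X) \<le> real n * real (vdeg E v)" by (intro mult_left_mono) auto
  thus ?thesis unfolding tau_def X_def using dpos \<epsilon>(1) by (simp add: field_simps)
qed

text \<open>Under \<open>J\<close> no coin removes a node that its position admits, so interesting
  means \<open>ok\<close> at its own rank. Interesting nodes hold all their edges, so the stored
  graph is the induced one.\<close>

lemma pivots_eq_piv:
  assumes xs: "xs \<in> orders"
    and J: "\<And>v. v \<in> V \<Longrightarrow> ok v (rank xs v) \<Longrightarrow> v \<in> leading_zeros V (class_index t (vdeg E v)) r"
  shows "pivots V \<epsilon> c (final_state t E r) xs = piv (rev xs)"
    and "u \<in> piv (rev xs) \<Longrightarrow> stored (final_state t E r) u = {e \<in> E. u \<in> e}"
proof -
  let ?s = "final_state t E r"
  define I where "I = {v \<in> V. ok v (rank xs v)}"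
  have fi: "final_interesting V \<epsilon> c ?s xs = I"
    using J unfolding final_interesting_def I_def by (auto simp: final_state_def leading_zeros_def)
  have st: "stored ?s u = {e \<in> E. u \<in> e}" if "u \<in> I" for u
    using that J unfolding I_def by (auto simp: final_state_def leading_zeros_def)
  have "e \<noteq> {}" if "e \<in> E" for e using that edge_cases by blast
  hence sg: "store_graph ?s I = {e \<in> E. e \<subseteq> I}"
    unfolding store_graph_def using st by fastforce
  let ?F = "{e \<in> E. e \<subseteq> I}"
  have pre: "greedy_mis ?F {} (filter (\<lambda>v. v \<in> I) p) = piv (rev p)" if "xs = p @ q" for p q
    using that
  proof (induction p arbitrary: q rule: rev_induct)
    case (snoc x p)
    have IH: "greedy_mis ?F {} (filter (\<lambda>v. v \<in> I) p) = piv (rev p)" using snoc by simp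
    \<comment> \<open>Pivots are interesting, so for an interesting \<open>x\<close> adjacency to a
      pivot is the same in the induced graph and in \<open>E\<close>.\<close>
    have sub: "piv (rev p) \<subseteq> I"
      using greedy_mis_subset[of ?F "{}" "filter (\<lambda>v. v \<in> I) p"] IH by auto
    have "x \<notin> set p" using order_props(1)[OF xs] snoc.prems by auto
    hence rk: "rank xs x = Suc (length p)" using snoc.prems rank_append_Cons[of x p q] by simp
    have "x \<in> V" using order_props(2)[OF xs] snoc.prems by auto
    hence xI: "x \<in> I \<longleftrightarrow> ok x (Suc (length p))" unfolding I_def using rk by simp
    show ?case
    proof (cases "x \<in> I")
      case False thus ?thesis using IH xI by simp
    next
      case True
      have "(\<exists>u\<in>piv (rev p). {u, x} \<in> ?F) \<longleftrightarrow> (\<exists>u\<in>piv (rev p). {u, x} \<in> E)" using sub True by auto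
      thus ?thesis using True xI IH by (simp add: greedy_mis_append)
    qed
  qed simp
  show "pivots V \<epsilon> c ?s xs = piv (rev xs)" unfolding pivots_def Let_def fi sg using pre[of xs "[]"] by simp
  have "piv (rev xs) \<subseteq> I"
    using greedy_mis_subset[of ?F "{}" "filter (\<lambda>v. v \<in> I) xs"] pre[of xs "[]"] by auto
  thus "u \<in> piv (rev xs) \<Longrightarrow> stored ?s u = {e \<in> E. u \<in> e}" using st by blast
qed

lemma output_clustering_eq_clusters:
  assumes xs: "xs \<in> orders"
    and J: "\<And>v. v \<in> V \<Longrightarrow> ok v (rank xs v) \<Longrightarrow> v \<in> leading_zeros V (class_index t (vdeg E v)) r"
  shows "output_clustering V \<epsilon> c (final_state t E r) xs = clusters xs"
proof -
  let ?s = "final_state t E r"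
  have "{u \<in> piv (rev xs). {u, v} \<in> stored ?s u} = {u \<in> piv (rev xs). {u, v} \<in> E}" for v
    using pivots_eq_piv(2)[OF assms] by auto
  moreover have "cur_deg ?s = vdeg E" by (simp add: final_state_def)
  moreover have "pivots V \<epsilon> c ?s xs = piv (rev xs)" by (rule pivots_eq_piv(1)[OF assms])
  ultimately have "cluster_label V \<epsilon> c ?s xs v = label xs v" for v
    unfolding cluster_label_def label_def Let_def by auto
  thus ?thesis unfolding output_clustering_def clusters_def by simp
qed

text \<open>This event depends on the strings alone and \<open>many_late\<close> on the order alone.
  Each is estimated under its own marginal and the probabilities are added, so their correlation
  does not matter.\<close>

definition few_zeros :: "('v \<Rightarrow> bool list) \<Rightarrow> bool" where
  "few_zeros r \<longleftrightarrow> (\<exists>v\<in>V. \<exists>j. class_index t (vdeg E v) = j \<and> j \<noteq> 0 \<and>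
     real (card (leading_zeros V j r)) < real n / 2 ^ j / 2)"

definition many_late :: "'v list \<Rightarrow> bool" where
  "many_late xs \<longleftrightarrow> (\<exists>v\<in>truncated xs. \<epsilon> / 16 * real (vdeg E v) < real (card (late_nbrs xs v)))"

text \<open>A pointwise bound, ready to be integrated over the joint law of strings and order.
  Outside both failure events \<open>cost_clusters_le\<close> applies with
  \<open>\<eta> = \<epsilon>/16\<close>.\<close>

lemma output_clustering_cost:
  assumes "xs \<in> compatible_orders V r"
  shows "real (clustering_cost V E (output_clustering V \<epsilon> c (final_state t E r) xs)) \<le>
    real (card (charged xs)) / (1 - \<epsilon> / 8) +
    (real n)\<^sup>2 * (indicator {r. few_zeros r} r + indicator {xs. many_late xs} xs)"
proof -
  let ?C = "real (clustering_cost V E (output_clustering V \<epsilon> c (final_state t E r) xs))"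
  have xs: "xs \<in> orders" using assms by (simp add: compatible_orders_def)
  have e8: "0 < 1 - \<epsilon> / 8" using \<epsilon> by simp
  have ch: "0 \<le> real (card (charged xs)) / (1 - \<epsilon> / 8)" using e8 by simp
  have "?C \<le> real (n\<^sup>2)" using clustering_cost_le_square[OF graph] of_nat_mono by blast
  hence sq: "?C \<le> (real n)\<^sup>2" by simp
  show ?thesis
  proof (cases "few_zeros r \<or> many_late xs")
    case True
    hence "(1::real) \<le> indicator {r. few_zeros r} r + indicator {xs. many_late xs} xs"
      by (auto simp: indicator_def)
    hence "(real n)\<^sup>2 * 1 \<le> (real n)\<^sup>2 * (indicator {r. few_zeros r} r + indicator {xs. many_late xs} xs)"
      by (intro mult_left_mono) auto
    thus ?thesis using sq ch by linarith
  next
    case False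
    have "v \<in> leading_zeros V (class_index t (vdeg E v)) r" if v: "v \<in> V" "ok v (rank xs v)" for v
    proof (cases "class_index t (vdeg E v) = 0")
      case True thus ?thesis using v by (simp add: leading_zeros_def)
    next
      case j: False
      hence "vdeg E v > 0" by (cases "vdeg E v") auto
      hence "real (rank xs v) < tau v" using v ok_iff by blast
      also have "\<dots> \<le> real n / 2 ^ class_index t (vdeg E v) / 2" using tau_le_class j by blast
      also have "\<dots> \<le> real (card (leading_zeros V (class_index t (vdeg E v)) r))"
        using False j v(1) unfolding few_zeros_def by (meson not_less)
      finally have "rank xs v \<le> card (leading_zeros V (class_index t (vdeg E v)) r)" by simp
      thus ?thesis by (rule rank_le_leading_zeros[OF finite_V assms v(1)])
    qed
    hence out: "output_clustering V \<epsilon> c (final_state t E r) xs = clusters xs"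
      by (rule output_clustering_eq_clusters[OF xs])
    have "(1 - 2 * (\<epsilon> / 16)) * ?C \<le> real (card (charged xs))"
      unfolding out by (rule cost_clusters_le[OF xs]) (use \<epsilon> False in \<open>auto simp: many_late_def not_less\<close>)
    hence "?C \<le> real (card (charged xs)) / (1 - \<epsilon> / 8)" using e8 by (simp add: field_simps)
    moreover have "0 \<le> (real n)\<^sup>2 * (indicator {r. few_zeros r} r + indicator {xs. many_late xs} xs)" by simp
    ultimately show ?thesis by linarith
  qed
qed

lemma vdeg_less: "v \<in> V \<Longrightarrow> vdeg E v < n"
  using vdeg_less_card[OF graph] .

text \<open>A nonzero class requires a degree above \<open>t\<close>, which is at least
  \<open>4/\<epsilon>\<close>, while degrees are below \<open>n\<close>.\<close>

lemma few_zeros_imp: assumes "few_zeros r" shows "1 < real n * \<epsilon>"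
proof -
  obtain v where v: "v \<in> V" "class_index t (vdeg E v) \<noteq> 0" using assms unfolding few_zeros_def by blast
  have "2 * t \<le> 2 ^ class_index t (vdeg E v) * t"
    using v(2) by (intro mult_le_mono1 self_le_power) auto
  also have "2 ^ class_index t (vdeg E v) * t < 2 * vdeg E v"
    by (rule class_index_lower) (use v(2) t_ge_2 in auto)
  finally have "t < n" using vdeg_less[OF v(1)] by simp
  hence "4 / \<epsilon> < real n" using t_lower_inverse by linarith
  thus ?thesis using \<epsilon> by (simp add: field_simps)
qed

text \<open>A threshold of at most \<open>n\<close> forces degree at least
  \<open>c/\<epsilon> * log 2 n\<close>, hence \<open>n > 1/\<epsilon>\<close>. The bound
  \<open>2 \<le> tau v\<close> is for the rounding of the threshold to an integer position.\<close>

lemma not_ok_imp: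
  assumes "v \<in> V" "\<not> ok v n"
  shows "vdeg E v > 0" "tau v \<le> real n" "2 \<le> tau v" "1 < real n * \<epsilon>"
proof -
  show d: "vdeg E v > 0" using assms by (cases "vdeg E v") (auto simp: below_tau_def)
  show tn: "tau v \<le> real n" using ok_iff[OF d] assms by (meson not_less)
  have dn: "real (vdeg E v) \<le> real n" using vdeg_less[OF assms(1)] by simp
  have ce: "1 / \<epsilon> \<le> c / \<epsilon> * log 2 (real n)"
  proof -
    have "1 / \<epsilon> * 1 \<le> c / \<epsilon> * log 2 (real n)"
      using \<epsilon> c log_n by (intro mult_mono divide_right_mono) auto
    thus ?thesis by simp
  qed
  have tau: "tau v = c / \<epsilon> * log 2 (real n) * (real n / real (vdeg E v))" by (simp add: tau_def)
  have "1 / \<epsilon> * 1 \<le> c / \<epsilon> * log 2 (real n) * (real n / real (vdeg E v))"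
    using d dn \<epsilon> ce c log_n by (intro mult_mono[OF ce]) (auto simp: field_simps)
  hence "1 / \<epsilon> \<le> tau v" unfolding tau by simp
  thus "2 \<le> tau v" using inv_\<epsilon> by linarith
  have "tau v * real (vdeg E v) \<le> real n * real (vdeg E v)" using tn by (intro mult_right_mono) auto
  moreover have "tau v * real (vdeg E v) = c / \<epsilon> * log 2 (real n) * real n" unfolding tau using d by simp
  ultimately have "c / \<epsilon> * log 2 (real n) * real n \<le> real (vdeg E v) * real n"
    by (simp only: mult.commute[of "real n"])
  hence "c / \<epsilon> * log 2 (real n) \<le> real (vdeg E v)"
    by (rule mult_right_le_imp_le) (use n2 in simp)
  hence "1 / \<epsilon> < real n" using ce vdeg_less[OF assms(1)] by linarith
  thus "1 < real n * \<epsilon>" using \<epsilon> by (simp add: field_simps)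
qed

lemma many_late_imp: "many_late xs \<Longrightarrow> xs \<in> orders \<Longrightarrow> 1 < real n * \<epsilon>"
  using not_ok_imp(4) truncated_not_ok unfolding many_late_def truncated_def by blast

lemma exp_log_le: "x \<ge> c / 32 \<Longrightarrow> exp (- x * log 2 (real n)) \<le> real n powr (- c / 32)"
proof -
  assume x: "x \<ge> c / 32"
  have "ln (real n) * 1 \<le> log 2 (real n)"
    using n2 ln2_le_25_over_36 by (simp add: log_def field_simps mult_le_cancel_left2)
  hence "c / 32 * ln (real n) \<le> x * log 2 (real n)"
    using x c n2 by (intro mult_mono) auto
  thus ?thesis using n2 by (simp add: powr_def)
qed

text \<open>An occupied class has \<open>2 ^ j * t < 2 * n\<close>, so the mean
  \<open>n / 2 ^ j\<close> is at least \<open>t/2\<close>, hence at least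
  \<open>2 * c * log 2 n\<close>. This beats the exponent \<open>c/32\<close>, which is dictated by
  \<open>prob_many_late\<close>.\<close>

lemma prob_few_zeros:
  assumes "real n \<le> 2 ^ L"
  shows "measure_pmf.prob (random_strings V L) {r. few_zeros r} \<le> real n * real n powr (- c / 32)"
proof -
  let ?U = "random_strings V L" and ?j = "\<lambda>v. class_index t (vdeg E v)"
  let ?A = "\<lambda>v. if ?j v = 0 then {} else {r. real (card (leading_zeros V (?j v) r)) < real n / 2 ^ ?j v / 2}"
  have "measure_pmf.prob ?U {r. few_zeros r} \<le> measure_pmf.prob ?U (\<Union>v\<in>V. ?A v)"
    by (rule measure_pmf.finite_measure_mono) (auto simp: few_zeros_def)
  also have "\<dots> \<le> (\<Sum>v\<in>V. measure_pmf.prob ?U (?A v))"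
    by (rule measure_pmf.finite_measure_subadditive_finite) (use finite_V in auto)
  also have "\<dots> \<le> (\<Sum>v\<in>V. real n powr (- c / 32))"
  proof (rule sum_mono)
    fix v assume v: "v \<in> V"
    show "measure_pmf.prob ?U (?A v) \<le> real n powr (- c / 32)"
    proof (cases "?j v = 0")
      case False
      have "?j v \<le> L" using class_index_length(1)[OF t_ge_2 vdeg_less[OF v] assms] .
      hence "measure_pmf.prob ?U (?A v) \<le> exp (- (11 / 72) * (real n / 2 ^ ?j v))"
        using leading_zeros_lower_tail[OF finite_V] False by simp
      also have "\<dots> \<le> exp (- (c / 32) * log 2 (real n))"
      proof -
        have "2 ^ ?j v * t < 2 * vdeg E v" using class_index_lower[OF _ False] t_ge_2 by simp
        hence "2 ^ ?j v * t \<le> 2 * n" using vdeg_less[OF v] by linarith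
        hence "real (2 ^ ?j v * t) \<le> real (2 * n)" by (simp only: of_nat_le_iff)
        hence a: "real t / 2 \<le> real n / 2 ^ ?j v" by (simp add: field_simps)
        have "2 * c * log 2 (real n) \<le> 2 * (c / \<epsilon>) * log 2 (real n)"
          using \<epsilon> c log_n by (intro mult_right_mono) (auto simp: field_simps)
        moreover have "2 * (c / \<epsilon>) * log 2 (real n) = (4 * c / \<epsilon> * log 2 (real n)) / 2" by simp
        ultimately have "2 * c * log 2 (real n) \<le> real n / 2 ^ ?j v" using a t_lower by linarith
        moreover have "c / 32 * log 2 (real n) \<le> 11 / 72 * (2 * c * log 2 (real n))"
          using c log_n by simp
        ultimately show ?thesis by simp
      qed
      also have "\<dots> \<le> real n powr (- c / 32)" by (rule exp_log_le) simp
      finally show ?thesis .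
    qed simp
  qed
  finally show ?thesis by simp
qed

lemma prob_many_late:
  "measure_pmf.prob (pmf_of_set orders) {xs. many_late xs} \<le> real n * real n powr (- c / 32)"
proof -
  let ?A = "\<lambda>v. {xs \<in> orders. v \<in> truncated xs \<and> \<epsilon> / 16 * real (vdeg E v) < real (card (late_nbrs xs v))}"
  have fo: "finite orders" "orders \<noteq> {}" using finite_V by auto
  have "measure_pmf.prob (pmf_of_set orders) {xs. many_late xs} = real (card (orders \<inter> {xs. many_late xs})) / fact n"
    using fo finite_V by (simp add: measure_pmf_of_set)
  also have "\<dots> \<le> (\<Sum>v\<in>V. real (card (?A v))) / fact n"
  proof (rule divide_right_mono)
    have "card (orders \<inter> {xs. many_late xs}) \<le> card (\<Union>v\<in>V. ?A v)"
      by (rule card_mono) (use finite_V in \<open>auto simp: many_late_def truncated_def\<close>)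
    also have "\<dots> \<le> (\<Sum>v\<in>V. card (?A v))" by (rule card_UN_le[OF finite_V])
    finally show "real (card (orders \<inter> {xs. many_late xs})) \<le> (\<Sum>v\<in>V. real (card (?A v)))"
      by (simp only: of_nat_sum[symmetric] of_nat_le_iff)
  qed simp
  also have "\<dots> = (\<Sum>v\<in>V. real (card (?A v)) / fact n)" by (rule sum_divide_distrib)
  also have "\<dots> \<le> (\<Sum>v\<in>V. real n powr (- c / 32))"
  proof (rule sum_mono)
    fix v assume v: "v \<in> V"
    show "real (card (?A v)) / fact n \<le> real n powr (- c / 32)"
    proof (cases "ok v n")
      case True
      hence "?A v = {}" using truncated_not_ok by blast
      thus ?thesis by (simp only: card.empty) simp
    next
      case False
      note f = not_ok_imp[OF v False]
      \<comment> \<open>The largest integer strictly below \<open>tau v\<close>, as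
        \<open>ok\<close> is a strict inequality; it is at least \<open>tau v / 2\<close> because
        \<open>tau v \<ge> 2\<close>.\<close>
      define k where "k = nat (\<lceil>tau v\<rceil> - 1)"
      have k: "ok v i \<longleftrightarrow> i \<le> k" for i
        unfolding ok_iff[OF f(1)] k_def using f(3) by linarith
      have kl: "tau v / 2 \<le> real k" unfolding k_def using f(3) by linarith
      have kn: "k \<le> n" unfolding k_def using f(2) by linarith
      let ?\<delta> = "\<epsilon> / 16 * real (vdeg E v)"
      have d0: "0 \<le> ?\<delta>" using \<epsilon> by simp
      have "?\<delta> \<le> 1 * real (vdeg E v)" using \<epsilon> by (intro mult_right_mono) auto
      hence dn: "?\<delta> \<le> real n" using vdeg_less[OF v] by linarith
      have np: "0 < real n" using n2 by simp
      have "real (card (?A v)) / fact n \<le> (1 - ?\<delta> / real n) ^ k"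
        using card_many_late_nbrs_le[OF v k kn d0 dn] by (simp add: field_simps)
      also have "\<dots> \<le> exp (- (?\<delta> / real n)) ^ k"
      proof (rule power_mono)
        show "1 - ?\<delta> / real n \<le> exp (- (?\<delta> / real n))"
          using exp_ge_add_one_self[of "- (?\<delta> / real n)"] by simp
        show "0 \<le> 1 - ?\<delta> / real n" using dn np by simp
      qed
      also have "\<dots> = exp (- (?\<delta> / real n * real k))"
        by (simp add: exp_of_nat_mult[symmetric] mult.commute)
      also have "\<dots> \<le> exp (- (c / 32) * log 2 (real n))"
      proof -
        have "?\<delta> / real n * (tau v / 2) \<le> ?\<delta> / real n * real k"
          using d0 kl by (intro mult_left_mono) auto
        \<comment> \<open>The degree in \<open>?\<delta>\<close> cancels against the one in
          \<open>tau v\<close>; \<open>32\<close> is \<open>16\<close> times the \<open>2\<close>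
          lost by rounding.\<close>
        moreover have "?\<delta> / real n * (tau v / 2) = c / 32 * log 2 (real n)"
          using f(1) \<epsilon> np unfolding tau_def by (simp add: field_simps)
        ultimately have "c / 32 * log 2 (real n) \<le> ?\<delta> / real n * real k" by linarith
        thus ?thesis by (simp only: exp_le_cancel_iff mult_minus_left neg_le_iff_le)
      qed
      also have "\<dots> \<le> real n powr (- c / 32)" by (rule exp_log_le) simp
      finally show ?thesis .
    qed
  qed
  finally show ?thesis by simp
qed

lemma expected_charged: "measure_pmf.expectation (pmf_of_set orders) (\<lambda>xs. real (card (charged xs))) \<le> 3 * real (OPT V E)"
proof -
  have fo: "finite orders" "orders \<noteq> {}" using finite_V by auto
  have cp: "0 < real (card orders)" using fo by (simp add: card_gt_0_iff)
  have "(\<Sum>xs\<in>orders. real (card (charged xs))) \<le> real (3 * (card orders * OPT V E))"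
    using sum_card_charged_le by (simp only: of_nat_sum[symmetric] of_nat_le_iff)
  moreover have "measure_pmf.expectation (pmf_of_set orders) (\<lambda>xs. real (card (charged xs))) =
    (\<Sum>xs\<in>orders. real (card (charged xs))) / real (card orders)"
    by (rule integral_pmf_of_set[OF fo(2,1)])
  ultimately show ?thesis using cp by (simp add: divide_le_eq mult_ac del: card_permutations_of_set)
qed

definition failure :: "nat \<Rightarrow> real" where
  "failure L = (real n)\<^sup>2 * (measure_pmf.prob (random_strings V L) {r. few_zeros r} +
     measure_pmf.prob (pmf_of_set orders) {xs. many_late xs})"

lemma expected_cost_le:
  assumes "adaptive_order E ne" "real n \<le> 2 ^ string_length n a"
  shows "measure_pmf.expectation (streaming_truncated_pivot \<epsilon> c a V E ne) (\<lambda>(P, m). real (clustering_cost V E P))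
    \<le> 3 * real (OPT V E) / (1 - \<epsilon> / 8) + failure (string_length n a)"
proof -
  let ?L = "string_length n a"
  let ?U = "random_strings V ?L"
  let ?out = "\<lambda>(r, xs). output_clustering V \<epsilon> c (final_state t E r) xs"
  \<comment> \<open>Joint law of strings and order, whose marginals are uniform strings and a
    uniform order.\<close>
  define Q where "Q = bind_pmf ?U (\<lambda>r. map_pmf (Pair r) (pmf_of_set (compatible_orders V r)))"
  have ne: "compatible_orders V r \<noteq> {}" for r using compatible_orders_nonempty[OF finite_V] .
  have finQ: "finite (set_pmf Q)"
    unfolding Q_def using finite_set_random_strings[OF finite_V]
    by (auto simp: ne finite_compatible_orders set_pmf_of_set)
  have int: "integrable (measure_pmf Q) g" for g :: "_ \<Rightarrow> real"
    by (rule integrable_measure_pmf_finite[OF finQ])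
  have Q1: "map_pmf fst Q = ?U"
    unfolding Q_def by (simp add: map_bind_pmf pmf.map_comp comp_def map_pmf_const bind_return_pmf')
  have Q2: "map_pmf snd Q = pmf_of_set orders"
    unfolding Q_def by (simp add: map_bind_pmf pmf.map_comp comp_def map_pmf_ident random_order_uniform[OF finite_V])
  have R: "map_pmf fst (streaming_truncated_pivot \<epsilon> c a V E ne) = map_pmf ?out Q"
    unfolding map_fst_streaming_truncated_pivot[OF graph assms(1) t_ge_2 assms(2)] Q_def
    by (simp add: map_bind_pmf pmf.map_comp comp_def)
  have "measure_pmf.expectation (streaming_truncated_pivot \<epsilon> c a V E ne) (\<lambda>(P, m). real (clustering_cost V E P)) =
    measure_pmf.expectation (map_pmf fst (streaming_truncated_pivot \<epsilon> c a V E ne)) (\<lambda>P. real (clustering_cost V E P))"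
    by (simp add: case_prod_unfold)
  also have "\<dots> = measure_pmf.expectation Q (\<lambda>q. real (clustering_cost V E (?out q)))"
    unfolding R by simp
  also have "\<dots> \<le> measure_pmf.expectation Q (\<lambda>q. real (card (charged (snd q))) / (1 - \<epsilon> / 8) +
      (real n)\<^sup>2 * (indicator {r. few_zeros r} (fst q) + indicator {xs. many_late xs} (snd q)))"
  proof (rule integral_mono_AE[OF int int])
    show "AE q in measure_pmf Q. real (clustering_cost V E (?out q)) \<le> real (card (charged (snd q))) / (1 - \<epsilon> / 8) +
      (real n)\<^sup>2 * (indicator {r. few_zeros r} (fst q) + indicator {xs. many_late xs} (snd q))"
    proof (rule AE_pmfI)
      fix q assume "q \<in> set_pmf Q"
      hence "snd q \<in> compatible_orders V (fst q)"
        unfolding Q_def by (auto simp: ne finite_compatible_orders set_pmf_of_set)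
      thus "real (clustering_cost V E (?out q)) \<le> real (card (charged (snd q))) / (1 - \<epsilon> / 8) +
        (real n)\<^sup>2 * (indicator {r. few_zeros r} (fst q) + indicator {xs. many_late xs} (snd q))"
        using output_clustering_cost by (simp add: case_prod_unfold)
    qed
  qed
  also have "\<dots> = measure_pmf.expectation Q (\<lambda>q. real (card (charged (snd q)))) / (1 - \<epsilon> / 8) +
    (real n)\<^sup>2 * (measure_pmf.expectation Q (\<lambda>q. indicator {r. few_zeros r} (fst q)) +
      measure_pmf.expectation Q (\<lambda>q. indicator {xs. many_late xs} (snd q)))"
    by (simp add: int)
  also have "measure_pmf.expectation Q (\<lambda>q. real (card (charged (snd q)))) =
    measure_pmf.expectation (pmf_of_set orders) (\<lambda>xs. real (card (charged xs)))"
    unfolding Q2[symmetric] by simp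
  also have "measure_pmf.expectation Q (\<lambda>q. indicator {r. few_zeros r} (fst q)) =
    measure_pmf.prob ?U {r. few_zeros r}"
  proof -
    have "measure_pmf.prob ?U {r. few_zeros r} = measure_pmf.expectation (map_pmf fst Q) (indicator {r. few_zeros r})"
      unfolding Q1 by simp
    thus ?thesis by (simp only: integral_map_pmf)
  qed
  also have "measure_pmf.expectation Q (\<lambda>q. indicator {xs. many_late xs} (snd q)) =
    measure_pmf.prob (pmf_of_set orders) {xs. many_late xs}"
  proof -
    have "measure_pmf.prob (pmf_of_set orders) {xs. many_late xs} =
        measure_pmf.expectation (map_pmf snd Q) (indicator {xs. many_late xs})"
      unfolding Q2 by simp
    thus ?thesis by (simp only: integral_map_pmf)
  qed
  also have "measure_pmf.expectation (pmf_of_set orders) (\<lambda>xs. real (card (charged xs))) / (1 - \<epsilon> / 8) +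
      (real n)\<^sup>2 * (measure_pmf.prob ?U {r. few_zeros r} + measure_pmf.prob (pmf_of_set orders) {xs. many_late xs})
    \<le> 3 * real (OPT V E) / (1 - \<epsilon> / 8) + failure ?L"
    unfolding failure_def using expected_charged \<epsilon> by (intro add_right_mono divide_right_mono) auto
  finally show ?thesis .
qed

text \<open>Cost \<open>n^2\<close>, a union bound over \<open>n\<close> nodes and two events give
  at most \<open>n^4\<close> times \<open>n powr (- c/32)\<close>; \<open>c/32 \<ge> c' + 7\<close>
  leaves \<open>n powr (- c' - 3)\<close>. The spare \<open>n powr (- 3)\<close> is below
  \<open>1 / (4 * n)\<close>, hence below \<open>\<epsilon>/4\<close> when
  \<open>n * \<epsilon> > 1\<close>; otherwise there are no failures.\<close>

lemma failure_le:
  assumes "real n \<le> 2 ^ L" "c \<ge> 32 * (c' + 7)" "c' > 0"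
  shows "failure L \<le> real n powr (- c')" "failure L \<le> \<epsilon> / 4"
proof -
  have n1: "1 \<le> real n" "2 \<le> real n" using n2 by auto
  have small: "failure L \<le> real n powr (- c' - 3)"
  proof -
    have "failure L \<le> (real n)\<^sup>2 * (real n * real n powr (- c / 32) + real n * real n powr (- c / 32))"
      unfolding failure_def using prob_few_zeros[OF assms(1)] prob_many_late
      by (intro mult_left_mono add_mono) auto
    also have "\<dots> = 2 * (real n) ^ 3 * real n powr (- c / 32)" by (simp add: power2_eq_square power3_eq_cube)
    also have "\<dots> \<le> real n * (real n) ^ 3 * real n powr (- c / 32)"
      using n1 by (intro mult_right_mono) auto
    also have "\<dots> = real n powr 4 * real n powr (- c / 32)"
      using n1 by (simp add: powr_numeral power_Suc[symmetric] eval_nat_numeral)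
    also have "\<dots> = real n powr (4 + - c / 32)" by (simp only: powr_add)
    also have "\<dots> \<le> real n powr (- c' - 3)" using assms(2) n1 by (intro powr_mono) auto
    finally show ?thesis .
  qed
  also have "\<dots> \<le> real n powr (- c')" using n1 by (intro powr_mono) auto
  finally show "failure L \<le> real n powr (- c')" .
  show "failure L \<le> \<epsilon> / 4"
  proof (cases "1 < real n * \<epsilon>")
    case True
    have "real n powr (- c' - 3) \<le> real n powr (- 3)" using assms(3) n1 by (intro powr_mono) auto
    also have "\<dots> = 1 / (real n) ^ 3" using n1 by (simp add: powr_minus_divide powr_numeral)
    also have "\<dots> \<le> 1 / (4 * real n)"
    proof -
      have "2 * 2 * real n \<le> real n * real n * real n" using n1 by (intro mult_mono) auto
      thus ?thesis using n1 by (intro divide_left_mono) (auto simp: power3_eq_cube)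
    qed
    also have "\<dots> \<le> \<epsilon> / 4" using True n1 by (simp add: field_simps)
    finally show ?thesis using small by simp
  next
    case False
    have fz: "{r. few_zeros r} = {}" using few_zeros_imp False by blast
    have "measure_pmf.prob (pmf_of_set orders) {xs. many_late xs} = 0"
      using many_late_imp False finite_V by (subst measure_pmf_zero_iff) (auto)
    thus ?thesis unfolding failure_def fz using \<epsilon> by simp
  qed
qed

end

section \<open>Memory\<close>

definition potential :: "'v set \<Rightarrow> real \<Rightarrow> 'v alg_state \<Rightarrow> real" where
  "potential V \<beta> s = (\<Prod>u\<in>V. 1 + (if interesting s u then \<beta> * 2 ^ length (bits s u) else 0))"

lemma potential_nonneg: "\<beta> \<ge> 0 \<Longrightarrow> 0 \<le> potential V \<beta> s"
  unfolding potential_def by (intro prod_nonneg) auto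

lemma finite_set_process_edge: "finite e \<Longrightarrow> finite (set_pmf (process_edge t e s))"
  unfolding process_edge_def Let_def
  by (auto intro!: finite_imageI finite_subset[OF set_Pi_pmf_subset'] finite_PiE_dflt)

text \<open>An interesting node that switches class doubles its factor's excess over 1 or loses it,
  each with probability one half.\<close>

lemma expectation_potential_process_edge:
  assumes "finite V" "e \<subseteq> V" "\<beta> \<ge> 0"
  shows "measure_pmf.expectation (process_edge t e s) (potential V \<beta>) = potential V \<beta> s"
proof -
  define W where "W = {u \<in> e. switches_class t (cur_deg s u) (cur_deg s u + 1)}"
  define p where "p = (\<lambda>u. if u \<in> W then fair_coin else return_pmf False)"
  define f where "f = (\<lambda>u b. 1 + (if interesting s u \<and> \<not> (u \<in> W \<and> b)
    then \<beta> * 2 ^ (length (bits s u) + (if u \<in> W then 1 else 0)) else 0))"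
  have W: "W \<subseteq> V" using assms(2) by (auto simp: W_def)
  have pi: "Pi_pmf W False (\<lambda>_. fair_coin) = Pi_pmf V False p"
    unfolding p_def by (rule Pi_pmf_extend[OF assms(1) W])
  have "measure_pmf.expectation (process_edge t e s) (potential V \<beta>) =
    measure_pmf.expectation (Pi_pmf V False p) (\<lambda>b. potential V \<beta> (update_state e W b s))"
    unfolding process_edge_def Let_def W_def[symmetric] pi by simp
  also have "\<dots> = measure_pmf.expectation (Pi_pmf V False p) (\<lambda>b. \<Prod>u\<in>V. f u (b u))"
    by (intro arg_cong[of _ _ "measure_pmf.expectation _"] ext)
       (auto simp: potential_def update_state_def f_def Let_def intro!: prod.cong)
  also have "\<dots> = (\<Prod>u\<in>V. measure_pmf.expectation (p u) (f u))"
    by (rule expectation_prod_Pi_pmf)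
       (use assms in \<open>auto simp: f_def p_def intro!: integrable_measure_pmf_finite\<close>)
  also have "\<dots> = potential V \<beta> s"
    unfolding potential_def
  proof (intro prod.cong refl)
    fix u
    show "measure_pmf.expectation (p u) (f u) = 1 + (if interesting s u then \<beta> * 2 ^ length (bits s u) else 0)"
      by (auto simp: p_def f_def add_divide_distrib)
  qed
  finally show ?thesis .
qed

lemma nn_integral_potential_process_edge:
  assumes "finite V" "e \<subseteq> V" "\<beta> \<ge> 0"
  shows "(\<integral>\<^sup>+s'. ennreal (potential V \<beta> s') \<partial>process_edge t e s) = ennreal (potential V \<beta> s)"
proof -
  have "finite e" using assms finite_subset by blast
  hence "integrable (measure_pmf (process_edge t e s)) (potential V \<beta>)"
    by (intro integrable_measure_pmf_finite finite_set_process_edge)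
  hence "(\<integral>\<^sup>+s'. ennreal (potential V \<beta> s') \<partial>process_edge t e s) =
      ennreal (measure_pmf.expectation (process_edge t e s) (potential V \<beta>))"
    by (rule nn_integral_eq_integral) (simp add: potential_nonneg[OF assms(3)])
  thus ?thesis by (simp add: expectation_potential_process_edge[OF assms])
qed

text \<open>Ville's maximal inequality, by freezing the potential at \<open>A\<close> once it has reached \<open>A\<close>. The
  adversary decides whose factor is next at stake, which does not affect the martingale property.\<close>

lemma potential_maximal_inequality:
  assumes "simple_graph V E" "adaptive_order E ne" "t > 0" "k \<le> card E" "\<beta> \<ge> 0" "A > 0"
  shows "measure_pmf.prob (stream_phase t ne k) {h. \<exists>(e, s)\<in>set h. A \<le> potential V \<beta> s}
    \<le> potential V \<beta> init_state / A"
proof -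
  have fV: "finite V" using assms(1) by (simp add: simple_graph_def)
  have fE: "finite E" by (rule simple_graph_finite_edges[OF assms(1)])
  define bad where "bad h \<longleftrightarrow> (\<exists>(e, s)\<in>set h. A \<le> potential V \<beta> s)" for h :: "'a history"
  define \<Psi> where "\<Psi> h = (if bad h then A else potential V \<beta> (cur_state h))" for h
  have main: "(\<integral>\<^sup>+h. ennreal (\<Psi> h) \<partial>stream_phase t ne k) \<le> ennreal (potential V \<beta> init_state)"
    using assms(4)
  proof (induction k)
    case 0
    show ?case by (simp add: nn_integral_return_pmf \<Psi>_def bad_def cur_state_def)
  next
    case (Suc k)
    have "(\<integral>\<^sup>+h. ennreal (\<Psi> h) \<partial>stream_phase t ne (Suc k)) =
      (\<integral>\<^sup>+h. \<integral>\<^sup>+s. ennreal (\<Psi> (h @ [(ne h, s)])) \<partial>process_edge t (ne h) (cur_state h) \<partial>stream_phase t ne k)"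
      by simp
    also have "\<dots> \<le> (\<integral>\<^sup>+h. ennreal (\<Psi> h) \<partial>stream_phase t ne k)"
    proof (rule nn_integral_mono_AE, rule AE_pmfI)
      fix h assume h: "h \<in> set_pmf (stream_phase t ne k)"
      have inv: "fst ` set h \<subseteq> E" "card (fst ` set h) = k"
        using stream_phase_inv[OF assms(3) fE assms(2) _ h] Suc.prems by auto
      hence "fst ` set h \<subset> E" using Suc.prems by auto
      hence "ne h \<in> E" using assms(2) unfolding adaptive_order_def by blast
      hence eV: "ne h \<subseteq> V" using assms(1) by (auto simp: simple_graph_def)
      show "(\<integral>\<^sup>+s. ennreal (\<Psi> (h @ [(ne h, s)])) \<partial>process_edge t (ne h) (cur_state h)) \<le> ennreal (\<Psi> h)"
      proof (cases "bad h")
        case True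
        hence "\<Psi> (h @ [(ne h, s)]) = A" for s by (auto simp: \<Psi>_def bad_def)
        thus ?thesis using True by (simp add: \<Psi>_def)
      next
        case False
        have "\<Psi> (h @ [(ne h, s)]) \<le> potential V \<beta> s" for s
          using False by (auto simp: \<Psi>_def bad_def cur_state_def)
        hence "(\<integral>\<^sup>+s. ennreal (\<Psi> (h @ [(ne h, s)])) \<partial>process_edge t (ne h) (cur_state h)) \<le>
          (\<integral>\<^sup>+s. ennreal (potential V \<beta> s) \<partial>process_edge t (ne h) (cur_state h))"
          by (intro nn_integral_mono ennreal_leI)
        also have "\<dots> = ennreal (\<Psi> h)"
          using False nn_integral_potential_process_edge[OF fV eV assms(5)] by (simp add: \<Psi>_def)
        finally show ?thesis .
      qed
    qed
    also have "\<dots> \<le> ennreal (potential V \<beta> init_state)" using Suc by simp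
    finally show ?case .
  qed
  have "ennreal A * emeasure (stream_phase t ne k) {h. bad h} =
      (\<integral>\<^sup>+h. ennreal A * indicator {h. bad h} h \<partial>stream_phase t ne k)"
    by (subst nn_integral_cmult) auto
  also have "\<dots> \<le> (\<integral>\<^sup>+h. ennreal (\<Psi> h) \<partial>stream_phase t ne k)"
    by (intro nn_integral_mono) (auto simp: \<Psi>_def indicator_def)
  also note main
  finally have "ennreal (A * measure_pmf.prob (stream_phase t ne k) {h. bad h}) \<le> ennreal (potential V \<beta> init_state)"
    using assms(6) by (simp add: measure_pmf.emeasure_eq_measure ennreal_mult)
  hence "A * measure_pmf.prob (stream_phase t ne k) {h. bad h} \<le> potential V \<beta> init_state"
    using ennreal_le_iff[OF potential_nonneg[OF assms(5), of V init_state]] by blast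
  thus ?thesis unfolding bad_def using assms(6) by (simp add: field_simps)
qed

text \<open>Dividing by \<open>n\<close> keeps each exponent \<open>x = deg / n\<close> in
  \<open>[0, 1]\<close>, where \<open>exp x \<le> 1 + x + x^2\<close>, hence at most
  \<open>1 + 2 * x\<close>. With \<open>deg \<le> 2 ^ j * t\<close> this is the factor of the
  potential for \<open>\<beta> = 2 * t / n\<close>.\<close>

lemma stored_sum_le_potential:
  assumes "simple_graph V E" "F \<subseteq> E" "state_inv t F s" "t > 0" "card V > 0"
  shows "exp ((\<Sum>u\<in>V. real (card (stored s u))) / real (card V)) \<le> potential V (2 * real t / real (card V)) s"
proof -
  have fV: "finite V" using assms(1) by (simp add: simple_graph_def)
  let ?n = "real (card V)"
  have "exp ((\<Sum>u\<in>V. real (card (stored s u))) / ?n) = (\<Prod>u\<in>V. exp (real (card (stored s u)) / ?n))"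
    by (simp add: sum_divide_distrib exp_sum[OF fV])
  also have "\<dots> \<le> potential V (2 * real t / ?n) s"
    unfolding potential_def
  proof (rule prod_mono)
    fix u assume u: "u \<in> V"
    let ?x = "real (card (stored s u)) / ?n"
    note I = assms(3)[unfolded state_inv_def, rule_format, of u]
    have deg: "vdeg F u < card V" by (rule vdeg_less_card[OF simple_graph_mono[OF assms(1,2)] u])
    have "exp ?x \<le> 1 + (if interesting s u then 2 * real t / ?n * 2 ^ length (bits s u) else 0)"
    proof (cases "interesting s u")
      case False
      thus ?thesis using I by simp
    next
      case True
      have st: "card (stored s u) = vdeg F u" using I True by (simp add: vdeg_def)
      have x: "0 \<le> ?x" "?x \<le> 1" using deg st assms(5) by auto
      have "exp ?x \<le> 1 + ?x + ?x\<^sup>2" using exp_bound[OF x] .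
      also have "\<dots> \<le> 1 + 2 * ?x"
      proof -
        have "?x * ?x \<le> ?x * 1" using x by (intro mult_left_mono) auto
        thus ?thesis unfolding power2_eq_square by linarith
      qed
      also have "\<dots> \<le> 1 + 2 * real t / ?n * 2 ^ length (bits s u)"
      proof -
        have "vdeg F u \<le> 2 ^ length (bits s u) * t" using class_index_upper[OF assms(4)] I by simp
        hence "real (vdeg F u) \<le> 2 ^ length (bits s u) * real t"
          by (metis of_nat_le_iff of_nat_mult of_nat_numeral of_nat_power)
        hence "2 * real (vdeg F u) / ?n \<le> 2 * (2 ^ length (bits s u) * real t) / ?n"
          by (intro divide_right_mono) auto
        thus ?thesis using st by (simp add: mult_ac)
      qed
      finally show ?thesis using True by simp
    qed
    thus "0 \<le> exp ?x \<and> exp ?x \<le> 1 + (if interesting s u then 2 * real t / ?n * 2 ^ length (bits s u) else 0)"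
      by simp
  qed
  finally show ?thesis .
qed

text \<open>The 3 counts the degree, the flag and one word for rounding up the string.\<close>

lemma state_words_le:
  assumes "\<And>u. u \<in> V \<Longrightarrow> real (length (bits s u)) \<le> x * real (word_bits (card V))" "word_bits (card V) > 0" "x \<ge> 0"
  shows "real (state_words V s) \<le> (3 + x) * real (card V) + 2 * (\<Sum>u\<in>V. real (card (stored s u)))"
proof -
  have "real (state_words V s) = (\<Sum>u\<in>V. 2 + real (nat \<lceil>real (length (bits s u)) / real (word_bits (card V))\<rceil>)
      + 2 * real (card (stored s u)))"
    by (simp add: state_words_def add.assoc)
  also have "\<dots> \<le> (\<Sum>u\<in>V. 3 + x + 2 * real (card (stored s u)))"
  proof (rule sum_mono)
    fix u assume "u \<in> V"
    hence "real (length (bits s u)) / real (word_bits (card V)) \<le> x"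
      using assms by (simp add: divide_le_eq)
    hence "real (nat \<lceil>real (length (bits s u)) / real (word_bits (card V))\<rceil>) \<le> x + 1" using assms(3) by linarith
    thus "2 + real (nat \<lceil>real (length (bits s u)) / real (word_bits (card V))\<rceil>) + 2 * real (card (stored s u))
      \<le> 3 + x + 2 * real (card (stored s u))" by simp
  qed
  also have "\<dots> = (3 + x) * real (card V) + 2 * (\<Sum>u\<in>V. real (card (stored s u)))"
    by (simp add: sum.distrib sum_distrib_left)
  finally show ?thesis .
qed

context pivot_params begin

lemma word_bits_lower: "log 2 (real n) \<le> real (word_bits n)" "word_bits n > 0"
  unfolding word_bits_def using log_n by linarith+

lemma bits_length_le:
  assumes "F \<subseteq> E" "state_inv t F s" "u \<in> V"
  shows "real (length (bits s u)) \<le> log 2 (real n)"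
proof -
  have deg: "vdeg F u < n" by (rule vdeg_less_card[OF simple_graph_mono[OF graph assms(1)] assms(3)])
  have "real n \<le> 2 ^ n" using less_exp[of n] by (metis less_imp_le of_nat_le_iff of_nat_numeral of_nat_power)
  hence "2 ^ class_index t (vdeg F u) \<le> n" by (rule class_index_length(2)[OF t_ge_2 deg])
  hence "2 ^ length (bits s u) \<le> n" using assms(2) by (simp add: state_inv_def)
  hence "2 ^ length (bits s u) \<le> real n" by (metis of_nat_le_iff of_nat_numeral of_nat_power)
  thus ?thesis using n2 by (subst le_log_iff) (auto simp: powr_realpow)
qed

text \<open>During the stream a string fits in one word; completed strings take at most
  \<open>a + 1\<close> words up to rounding. The three extra words at the end give
  \<open>3 + (a + 1) + 3 = a + 7\<close>.\<close>

lemma peak_words_le: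
  assumes "adaptive_order E ne" "a \<ge> 1" "real n \<le> 2 ^ string_length n a"
    and h: "h \<in> set_pmf (stream_phase t ne (card E))"
    and r: "r \<in> set_pmf (complete_strings V (string_length n a) (cur_state h))"
    and good: "\<And>e s. (e, s) \<in> set h \<Longrightarrow> (\<Sum>u\<in>V. real (card (stored s u))) \<le> S" and "S \<ge> 0"
  shows "real (peak_words V h r) \<le> (a + 7) * real n + 2 * S"
proof -
  let ?s = "cur_state h" and ?L = "string_length n a"
  note inv = stream_phase_inv[OF _ finite_E assms(1) order_refl h]
  have tpos: "t > 0" using t_ge_2 by simp
  have 1: "real (state_words V init_state) \<le> (a + 7) * real n + 2 * S"
  proof -
    have "real (state_words V init_state) = 2 * real n" by (simp add: state_words_def init_state_def)
    also have "\<dots> \<le> (a + 7) * real n" using assms(2) by (intro mult_right_mono) auto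
    finally show ?thesis using assms(7) by simp
  qed
  have 2: "real (state_words V s) \<le> (a + 7) * real n + 2 * S" if es: "(e, s) \<in> set h" for e s
  proof -
    obtain F where F: "F \<subseteq> E" "state_inv t F s" using inv[OF tpos] es by blast
    have "real (state_words V s) \<le> (3 + 1) * real n + 2 * (\<Sum>u\<in>V. real (card (stored s u)))"
      by (rule state_words_le) (use bits_length_le[OF F] word_bits_lower in fastforce)+
    moreover have "(3 + 1) * real n \<le> (a + 7) * real n"
      by (rule mult_right_mono) (use assms(2) in auto)
    ultimately show ?thesis using good[OF es] by linarith
  qed
  have 3: "real (state_words V (?s\<lparr>bits := r\<rparr>) + 3 * n) \<le> (a + 7) * real n + 2 * S"
  proof -
    have sinv: "state_inv t (fst ` set h) ?s" "fst ` set h \<subseteq> E" using inv[OF tpos] by auto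
    have len: "length (r u) = ?L" if u: "u \<in> V" for u
    proof -
      have "length (bits ?s u) \<le> ?L"
      proof -
        have "vdeg (fst ` set h) u < n" by (rule vdeg_less_card[OF simple_graph_mono[OF graph sinv(2)] u])
        thus ?thesis using class_index_length(1)[OF t_ge_2 _ assms(3)] sinv(1) by (simp add: state_inv_def)
      qed
      moreover have "r u \<in> set_pmf (map_pmf (\<lambda>x. bits ?s u @ x) (replicate_pmf (?L - length (bits ?s u)) fair_coin))"
        using r u set_Pi_pmf_subset'[OF finite_V] unfolding complete_strings_def PiE_dflt_def by fastforce
      ultimately show ?thesis by (auto simp: set_replicate_pmf)
    qed
    have Lle: "real ?L \<le> (a + 1) * real (word_bits n)"
    proof -
      have "0 \<le> a * log 2 (real n)" using assms(2) log_n by simp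
      hence "real ?L \<le> a * log 2 (real n) + 1" unfolding string_length_def by linarith
      also have "\<dots> \<le> a * real (word_bits n) + real (word_bits n)"
        using assms(2) word_bits_lower by (intro add_mono mult_left_mono) auto
      finally show ?thesis by (simp add: algebra_simps)
    qed
    have st: "(\<Sum>u\<in>V. real (card (stored ?s u))) \<le> S"
    proof (cases "h = []")
      case True
      thus ?thesis using assms(7) by (simp add: cur_state_def init_state_def)
    next
      case False
      hence "(fst (last h), ?s) \<in> set h" by (simp add: cur_state_def)
      thus ?thesis by (rule good)
    qed
    have "real (state_words V (?s\<lparr>bits := r\<rparr>)) \<le> (3 + (a + 1)) * real n + 2 * (\<Sum>u\<in>V. real (card (stored (?s\<lparr>bits := r\<rparr>) u)))"
      by (rule state_words_le) (use len Lle word_bits_lower assms(2) in auto)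
    hence "real (state_words V (?s\<lparr>bits := r\<rparr>)) \<le> (3 + (a + 1)) * real n + 2 * S" using st by simp
    thus ?thesis by (simp add: algebra_simps)
  qed
  have "peak_words V h r \<in> insert (state_words V init_state)
       (insert (state_words V (?s\<lparr>bits := r\<rparr>) + 3 * n) ((\<lambda>(e, s). state_words V s) ` set h))"
    unfolding peak_words_def by (rule Max_in) auto
  thus ?thesis using 1 2 3 by auto
qed

lemma memory_bound:
  assumes "adaptive_order E ne" "a \<ge> 1" "real n \<le> 2 ^ string_length n a" "c' > 0"
    and B: "B = (a + 7) * real n + 2 * (real n * (2 * real t + c' * ln (real n)))"
  shows "measure_pmf.prob (streaming_truncated_pivot \<epsilon> c a V E ne) {(P, m). real m \<le> B} \<ge> 1 - real n powr (- c')"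
proof -
  let ?R = "streaming_truncated_pivot \<epsilon> c a V E ne"
  let ?S = "stream_phase t ne (card E)"
  have np: "0 < real n" using n2 by simp
  have tpos: "t > 0" using t_ge_2 by simp
  define \<beta> where "\<beta> = 2 * real t / real n"
  \<comment> \<open>The first term pays for the initial potential
    \<open>(1 + \<beta>) ^ n \<le> exp (2 * t)\<close>, the second buys the probability
    \<open>n powr (- c')\<close>.\<close>
  define A where "A = exp (2 * real t + c' * ln (real n))"
  define bad where "bad = {h :: 'v history. \<exists>(e, s)\<in>set h. A \<le> potential V \<beta> s}"
  have \<beta>0: "\<beta> \<ge> 0" by (simp add: \<beta>_def)
  have "potential V \<beta> init_state = (1 + \<beta>) ^ n" by (simp add: potential_def init_state_def)
  also have "\<dots> \<le> exp \<beta> ^ n" using \<beta>0 exp_ge_add_one_self[of \<beta>] by (intro power_mono) auto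
  also have "\<dots> = exp (2 * real t)" using np by (simp add: exp_of_nat_mult[symmetric] \<beta>_def)
  finally have init: "potential V \<beta> init_state \<le> exp (2 * real t)" .
  have "measure_pmf.prob ?S bad \<le> potential V \<beta> init_state / A"
    unfolding bad_def by (rule potential_maximal_inequality[OF graph assms(1) tpos order_refl \<beta>0]) (simp add: A_def)
  also have "\<dots> \<le> exp (2 * real t) / A" using init by (intro divide_right_mono) (auto simp: A_def)
  also have "\<dots> = real n powr (- c')" using np by (simp add: A_def exp_add powr_def exp_minus field_simps)
  finally have pbad: "measure_pmf.prob ?S bad \<le> real n powr (- c')" .
  \<comment> \<open>The run after the history \<open>h\<close>. On a good history no completion of
    the strings exceeds \<open>B\<close>, so only the randomness of the stream contributes.\<close>
  define N where "N h = bind_pmf (complete_strings V (string_length n a) (cur_state h)) (\<lambda>r.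
     bind_pmf (pmf_of_set (compatible_orders V r)) (\<lambda>xs.
     return_pmf (output_clustering V \<epsilon> c (cur_state h) xs, peak_words V h r)))" for h
  let ?X = "{(P :: 'v set set, m). \<not> real m \<le> B}"
  have R: "?R = bind_pmf ?S N" unfolding streaming_truncated_pivot_def N_def ..
  have zero: "emeasure (N h) ?X \<le> indicator bad h" if h: "h \<in> set_pmf ?S" for h
  proof (cases "h \<in> bad")
    case True thus ?thesis by (simp add: measure_pmf.emeasure_le_1)
  next
    case False
    let ?S0 = "real n * (2 * real t + c' * ln (real n))"
    have S0: "0 \<le> ?S0" using assms(4) n2 by simp
    have good: "(\<Sum>u\<in>V. real (card (stored s u))) \<le> ?S0" if es: "(e, s) \<in> set h" for e s
    proof -
      obtain F where F: "F \<subseteq> E" "state_inv t F s"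
        using stream_phase_inv[OF tpos finite_E assms(1) order_refl h] es by blast
      have "exp ((\<Sum>u\<in>V. real (card (stored s u))) / real n) \<le> potential V \<beta> s"
        unfolding \<beta>_def by (rule stored_sum_le_potential[OF graph F tpos]) (use n2 in simp)
      also have "\<dots> < A" using False es unfolding bad_def by force
      finally have "(\<Sum>u\<in>V. real (card (stored s u))) / real n \<le> 2 * real t + c' * ln (real n)"
        by (simp add: A_def)
      thus ?thesis using np by (simp add: field_simps)
    qed
    have "set_pmf (N h) \<inter> ?X = {}"
    proof -
      have "real (peak_words V h r) \<le> B" if "r \<in> set_pmf (complete_strings V (string_length n a) (cur_state h))" for r
        unfolding B by (rule peak_words_le[OF assms(1-3) h that good S0])
      thus ?thesis unfolding N_def by auto
    qed
    hence "emeasure (N h) ?X = 0" by (simp add: measure_pmf_zero_iff measure_pmf.emeasure_eq_measure)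
    thus ?thesis by simp
  qed
  have "emeasure ?R ?X = (\<integral>\<^sup>+h. emeasure (N h) ?X \<partial>?S)" unfolding R by (rule emeasure_bind_pmf)
  also have "\<dots> \<le> (\<integral>\<^sup>+h. indicator bad h \<partial>?S)"
    by (intro nn_integral_mono_AE AE_pmfI zero)
  also have "\<dots> = emeasure ?S bad" by simp
  finally have "measure_pmf.prob ?R ?X \<le> measure_pmf.prob ?S bad"
    by (simp add: measure_pmf.emeasure_eq_measure)
  hence "measure_pmf.prob ?R ?X \<le> real n powr (- c')" using pbad by simp
  moreover have "measure_pmf.prob ?R ?X = 1 - measure_pmf.prob ?R {(P, m). real m \<le> B}"
  proof -
    have "?X = UNIV - {(P, m). real m \<le> B}" by auto
    thus ?thesis using measure_pmf.prob_compl[of "{(P, m). real m \<le> B}" ?R] by simp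
  qed
  ultimately show ?thesis by simp
qed

lemma memory_constant:
  assumes "a \<ge> 1" "c' > 0"
  shows "(a + 7) * real n + 2 * (real n * (2 * real t + c' * ln (real n))) \<le>
    (a + 7 + 4 * (4 * c + 1) + 2 * c') * (real n * log 2 (real n) / \<epsilon>)"
proof -
  \<comment> \<open>Since \<open>q \<ge> 1\<close> and \<open>q \<ge> log 2 n\<close>, every summand
    is absorbed into a multiple of \<open>n * q\<close> whose factor is free of
    \<open>\<epsilon>\<close> and \<open>n\<close>.\<close>
  define q where "q = log 2 (real n) / \<epsilon>"
  have "1 * 1 \<le> log 2 (real n) * (1 / \<epsilon>)" using log_n inv_\<epsilon> by (intro mult_mono) auto
  hence q1: "1 \<le> q" by (simp add: q_def)
  have "log 2 (real n) * 1 \<le> log 2 (real n) * (1 / \<epsilon>)" using log_n inv_\<epsilon> by (intro mult_left_mono) auto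
  hence lq: "log 2 (real n) \<le> q" by (simp add: q_def)
  have "ln (real n) * 1 \<le> log 2 (real n)"
    using n2 ln2_le_25_over_36 by (simp add: log_def field_simps mult_le_cancel_left2)
  hence lnq: "c' * ln (real n) \<le> c' * q" using lq assms(2) by (intro mult_left_mono) auto
  have "0 \<le> 4 * c / \<epsilon> * log 2 (real n)" using c \<epsilon> log_n by simp
  hence "real t \<le> 4 * c / \<epsilon> * log 2 (real n) + 1" unfolding theta0_def by linarith
  also have "4 * c / \<epsilon> * log 2 (real n) = 4 * c * q" by (simp add: q_def)
  finally have tq: "real t \<le> (4 * c + 1) * q" using q1 by (simp add: distrib_right)
  have "(a + 7) * 1 \<le> (a + 7) * q" using q1 assms(1) by (intro mult_left_mono) auto
  hence aq: "a + 7 \<le> (a + 7) * q" by simp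
  have tlq: "2 * real t + c' * ln (real n) \<le> 2 * ((4 * c + 1) * q) + c' * q"
    by (rule add_mono[OF _ lnq]) (use tq in simp)
  have "a + 7 + 2 * (2 * real t + c' * ln (real n)) \<le> (a + 7) * q + 2 * (2 * ((4 * c + 1) * q) + c' * q)"
    by (rule add_mono[OF aq]) (use tlq in simp)
  also have "\<dots> = (a + 7 + 4 * (4 * c + 1) + 2 * c') * q" by (simp add: algebra_simps)
  finally have "real n * (a + 7 + 2 * (2 * real t + c' * ln (real n))) \<le>
      real n * ((a + 7 + 4 * (4 * c + 1) + 2 * c') * q)"
    by (intro mult_left_mono) auto
  thus ?thesis by (simp add: q_def algebra_simps)
qed

text \<open>Of the slack \<open>\<epsilon>\<close>, three quarters go to the truncation; the last
  quarter is kept for the failure events.\<close>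

lemma approximation_ratio:
  "3 * real k / (1 - \<epsilon> / 8) \<le> (3 + 3 * \<epsilon> / 4) * real k"
proof -
  have "3 \<le> (3 + 3 * \<epsilon> / 4) * (1 - \<epsilon> / 8)"
  proof -
    have "(3 + 3 * \<epsilon> / 4) * (1 - \<epsilon> / 8) = 3 + 3 / 32 * \<epsilon> * (4 - \<epsilon>)" by (simp add: field_simps)
    moreover have "0 \<le> 3 / 32 * \<epsilon> * (4 - \<epsilon>)" using \<epsilon> by simp
    ultimately show ?thesis by linarith
  qed
  hence "3 / (1 - \<epsilon> / 8) \<le> 3 + 3 * \<epsilon> / 4" using \<epsilon> by (simp add: divide_le_eq)
  hence "3 / (1 - \<epsilon> / 8) * real k \<le> (3 + 3 * \<epsilon> / 4) * real k" by (intro mult_right_mono) auto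
  thus ?thesis by simp
qed

end

lemma string_length_lower:
  assumes "a \<ge> 1" "n > 0"
  shows "real n \<le> 2 ^ string_length n a"
proof -
  have "0 \<le> log 2 (real n)" using assms(2) by simp
  hence "1 * log 2 (real n) \<le> a * log 2 (real n)" using assms(1) by (intro mult_right_mono) auto
  hence "log 2 (real n) \<le> real (string_length n a)" unfolding string_length_def by linarith
  hence "2 powr log 2 (real n) \<le> 2 powr real (string_length n a)" by (intro powr_mono) auto
  thus ?thesis using assms(2) by (simp add: powr_realpow)
qed

lemma output_clustering_partition: "partition_on V (output_clustering V \<epsilon> c s xs)"
  unfolding output_clustering_def by (auto simp: partition_on_def disjoint_def)

lemma clustering_cost_trivial:
  assumes "simple_graph V E" "card V < 2"
  shows "clustering_cost V E P = 0"
proof -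
  have fV: "finite V" using assms(1) by (simp add: simple_graph_def)
  have "\<not> (e \<subseteq> V \<and> card e = 2)" for e using card_mono[OF fV, of e] assms(2) by auto
  hence "error_pairs V E P = {}" using assms(1) by (auto simp: error_pairs_def simple_graph_def)
  thus ?thesis using clustering_cost_eq_card_error_pairs[OF assms(1)] by simp
qed

text \<open>For \<open>OPT = 0\<close> a purely multiplicative bound would leave no room for
  failures, so their contribution is stated instead. On a single node the logarithm vanishes and the
  memory bound would be 0, hence \<open>n \<ge> 2\<close> there. The order of quantifiers makes
  \<open>c\<^sub>0\<close> depend on \<open>c'\<close> only and \<open>K\<close> independent of
  \<open>\<epsilon>\<close>, the graph and the adversary.\<close>

theorem theorem2:
  fixes c' :: real
  assumes "c' > 0"
  shows "\<exists>c\<^sub>0>0. \<forall>c\<ge>c\<^sub>0. \<forall>a\<ge>1. \<exists>K>0. \<forall>\<epsilon>::real. 0 < \<epsilon> \<and> \<epsilon> < 1 / 4 \<longrightarrow>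
    (\<forall>(V :: 'v set) E next_edge. simple_graph V E \<and> adaptive_order E next_edge \<longrightarrow>
      (let n = card V;
           R = streaming_truncated_pivot \<epsilon> c a V E next_edge;
           expected_cost = measure_pmf.expectation R (\<lambda>(P, m). real (clustering_cost V E P))
       in (\<forall>(P, m)\<in>set_pmf R. partition_on V P) \<and>
          (OPT V E > 0 \<longrightarrow> expected_cost \<le> (3 + \<epsilon>) * real (OPT V E)) \<and>
          (OPT V E = 0 \<longrightarrow> expected_cost \<le> real n powr (- c')) \<and>
          (n \<ge> 2 \<longrightarrow>
             measure_pmf.prob R {(P, m). real m \<le> K * (real n * log 2 (real n) / \<epsilon>)}
               \<ge> 1 - real n powr (- c'))))"
proof (rule exI[of _ "32 * (c' + 7)"], intro conjI allI impI)
  show "0 < 32 * (c' + 7)" using assms by simp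
  fix c a :: real assume c_large: "32 * (c' + 7) \<le> c" and a: "1 \<le> a"
  define K where "K = a + 7 + 4 * (4 * c + 1) + 2 * c'"
  show "\<exists>K>0. \<forall>\<epsilon>::real. 0 < \<epsilon> \<and> \<epsilon> < 1 / 4 \<longrightarrow>
    (\<forall>(V :: 'v set) E next_edge. simple_graph V E \<and> adaptive_order E next_edge \<longrightarrow>
      (let n = card V;
           R = streaming_truncated_pivot \<epsilon> c a V E next_edge;
           expected_cost = measure_pmf.expectation R (\<lambda>(P, m). real (clustering_cost V E P))
       in (\<forall>(P, m)\<in>set_pmf R. partition_on V P) \<and>
          (OPT V E > 0 \<longrightarrow> expected_cost \<le> (3 + \<epsilon>) * real (OPT V E)) \<and>
          (OPT V E = 0 \<longrightarrow> expected_cost \<le> real n powr (- c')) \<and>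
          (n \<ge> 2 \<longrightarrow>
             measure_pmf.prob R {(P, m). real m \<le> K * (real n * log 2 (real n) / \<epsilon>)}
               \<ge> 1 - real n powr (- c'))))"
  proof (rule exI[of _ K], intro conjI allI impI)
    show "0 < K" unfolding K_def using a c_large assms by simp
    fix \<epsilon> :: real and V :: "'v set" and E next_edge
    assume "0 < \<epsilon> \<and> \<epsilon> < 1 / 4" and VE: "simple_graph V E \<and> adaptive_order E next_edge"
    hence \<epsilon>: "0 < \<epsilon>" "\<epsilon> < 1 / 4" and g: "simple_graph V E" and ad: "adaptive_order E next_edge" by auto
    let ?n = "card V" and ?R = "streaming_truncated_pivot \<epsilon> c a V E next_edge"
    let ?cost = "measure_pmf.expectation ?R (\<lambda>(P, m). real (clustering_cost V E P))"
    have part: "\<forall>(P, m)\<in>set_pmf ?R. partition_on V P"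
      unfolding streaming_truncated_pivot_def by (auto simp: output_clustering_partition)
    have "(OPT V E > 0 \<longrightarrow> ?cost \<le> (3 + \<epsilon>) * real (OPT V E)) \<and>
      (OPT V E = 0 \<longrightarrow> ?cost \<le> real ?n powr (- c')) \<and>
      (?n \<ge> 2 \<longrightarrow> measure_pmf.prob ?R {(P, m). real m \<le> K * (real ?n * log 2 (real ?n) / \<epsilon>)}
        \<ge> 1 - real ?n powr (- c'))"
    proof (cases "?n \<ge> 2")
      case False
      hence "?cost = 0" using clustering_cost_trivial[OF g] by (simp add: case_prod_unfold)
      thus ?thesis using False \<epsilon> by simp
    next
      case True
      interpret pivot_params V E \<epsilon> c
        by unfold_locales (use g \<epsilon> True c_large assms in auto)
      have L: "real ?n \<le> 2 ^ string_length ?n a" using string_length_lower[OF a] True by simp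
      note cost = expected_cost_le[OF ad L]
      note fail = failure_le[OF L c_large assms]
      have "?cost \<le> (3 + \<epsilon>) * real (OPT V E)" if "OPT V E > 0"
      proof -
        have "?cost \<le> (3 + 3 * \<epsilon> / 4) * real (OPT V E) + \<epsilon> / 4 * 1"
          using cost fail(2) approximation_ratio[of "OPT V E"] by linarith
        \<comment> \<open>A positive optimum is at least 1 because it is an integer.\<close>
        also have "\<dots> \<le> (3 + 3 * \<epsilon> / 4) * real (OPT V E) + \<epsilon> / 4 * real (OPT V E)"
          using that \<epsilon> by (intro add_left_mono mult_left_mono) auto
        finally show ?thesis by (simp add: algebra_simps)
      qed
      moreover have "?cost \<le> real ?n powr (- c')" if "OPT V E = 0"
        using cost fail(1) that by simp
      moreover have "measure_pmf.prob ?R {(P, m). real m \<le> K * (real ?n * log 2 (real ?n) / \<epsilon>)} \<ge> 1 - real ?n powr (- c')"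
      proof -
        let ?B = "(a + 7) * real n + 2 * (real n * (2 * real t + c' * ln (real n)))"
        have "measure_pmf.prob ?R {(P, m). real m \<le> ?B} \<le>
            measure_pmf.prob ?R {(P, m). real m \<le> K * (real ?n * log 2 (real ?n) / \<epsilon>)}"
          using memory_constant[OF a assms] unfolding K_def
          by (intro measure_pmf.finite_measure_mono) (auto elim: order_trans)
        thus ?thesis using memory_bound[OF ad a L assms refl] by linarith
      qed
      ultimately show ?thesis by blast
    qed
    thus "let n = card V; R = ?R;
           expected_cost = measure_pmf.expectation R (\<lambda>(P, m). real (clustering_cost V E P))
       in (\<forall>(P, m)\<in>set_pmf R. partition_on V P) \<and>
          (OPT V E > 0 \<longrightarrow> expected_cost \<le> (3 + \<epsilon>) * real (OPT V E)) \<and>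
          (OPT V E = 0 \<longrightarrow> expected_cost \<le> real n powr (- c')) \<and>
          (n \<ge> 2 \<longrightarrow>
             measure_pmf.prob R {(P, m). real m \<le> K * (real n * log 2 (real n) / \<epsilon>)}
               \<ge> 1 - real n powr (- c'))"
      using part unfolding Let_def by blast
  qed
qed

end
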